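(* There is an absolute constant $c>0$ such that for all $0<\epsilon,\delta<1$ and every sufficiently large dimension $n$ (depending on $\epsilon,\delta$), every trace estimator that is an $(\epsilon,\delta)$-estimator for the class of symmetric positive semidefinite $n\times n$ matrices makes at least $c\cdot\frac{1}{\epsilon^2}\log\frac{1}{\delta}$ queries; i.e., any $(\epsilon,\delta)$-estimator requires $\Omega(\frac{1}{\epsilon^2}\log\frac1\delta)$ queries even if the unknown matrix is known to be positive semidefinite.
   Context: For an unknown real $n\times n$ matrix $A$, the oracle is $f_A(x)=x^TAx$ for $x\in\mathbb{R}^n$. A trace estimator making $k$ queries is a randomized algorithm that chooses queries $x_1,\dots,x_k\in\mathbb{R}^n$, possibly adaptively (the distribution of $x_i$ may depend on previous queries and answers), receives $f_A(x_1),\dots,f_A(x_k)$, and outputs a real number $h(A)$, which may be any (possibly randomized) function of the queries and answers. It is an $(\epsilon,\delta)$-estimator for a class of matrices if for every matrix $A$ in the class, with probability at least $1-\delta$ over the internal randomness, $|\mathrm{trace}(A)-h(A)|\le\epsilon\,\mathrm{trace}(A)$.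
   Formalization: The constant c is not absolute on all 0<ε,δ<1 (that is false near ε=1 or δ=1): for any fixed ε₀,δ₀<1 there is a c>0, depending on ε₀,δ₀, that works for all 0<ε≤ε₀, 0<δ≤δ₀. *)

theory Defs
  imports "HOL-Probability.Probability" "Jordan_Normal_Form.Matrix"
begin

definition mat_trace :: "real mat \<Rightarrow> real" where
  "mat_trace A = (\<Sum>i<dim_row A. A $$ (i, i))"

definition psd_matrices :: "nat \<Rightarrow> real mat set" where
  "psd_matrices n = {A \<in> carrier_mat n n. transpose_mat A = A \<and>
     (\<forall>v \<in> carrier_vec n. 0 \<le> scalar_prod v (A *\<^sub>v v))}"

text \<open>
  The type \<^typ>\<open>real vec\<close> carries no sigma-algebra, so a random query in \<open>\<real>\<^sup>n\<close> is a point of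
  the product space of \<open>n\<close> copies of \<open>borel\<close>, and is turned into a vector by \<^term>\<open>vec n\<close>.
\<close>

type_synonym query = "nat \<Rightarrow> real"
type_synonym history = "nat \<Rightarrow> query \<times> real"

definition query_space :: "nat \<Rightarrow> query measure" where
  "query_space n = (\<Pi>\<^sub>M j\<in>{..<n}. borel)"

definition history_space :: "nat \<Rightarrow> nat \<Rightarrow> history measure" where
  "history_space n i = (\<Pi>\<^sub>M j\<in>{..<i}. query_space n \<Otimes>\<^sub>M borel)"

definition oracle_answer :: "nat \<Rightarrow> real mat \<Rightarrow> query \<Rightarrow> real" where
  "oracle_answer n A x = scalar_prod (vec n x) (A *\<^sub>v vec n x)"

text \<open>
  The randomness of the algorithm is expressed by Markov kernels: \<open>Q i h\<close> is the distribution of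
  the next query when the first \<open>i\<close> query-answer pairs are \<open>h 0, \<dots>, h (i - 1)\<close>, and \<open>H h\<close> is the
  distribution of the output given all \<open>k\<close> pairs. None of them depends on the matrix.
\<close>

definition trace_estimator ::
    "nat \<Rightarrow> nat \<Rightarrow> (nat \<Rightarrow> history \<Rightarrow> query measure) \<Rightarrow> (history \<Rightarrow> real measure) \<Rightarrow> bool" where
  "trace_estimator n k Q H \<longleftrightarrow>
     (\<forall>i<k. Q i \<in> history_space n i \<rightarrow>\<^sub>M prob_algebra (query_space n)) \<and>
     H \<in> history_space n k \<rightarrow>\<^sub>M prob_algebra borel"

primrec transcript ::
    "nat \<Rightarrow> (nat \<Rightarrow> history \<Rightarrow> query measure) \<Rightarrow> real mat \<Rightarrow> nat \<Rightarrow> history measure" where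
  "transcript n Q A 0 = return (history_space n 0) (\<lambda>_. undefined)"
| "transcript n Q A (Suc i) = transcript n Q A i \<bind>
     (\<lambda>h. distr (Q i h) (history_space n (Suc i)) (\<lambda>x. h(i := (x, oracle_answer n A x))))"

definition estimate ::
    "nat \<Rightarrow> nat \<Rightarrow> (nat \<Rightarrow> history \<Rightarrow> query measure) \<Rightarrow> (history \<Rightarrow> real measure) \<Rightarrow> real mat \<Rightarrow> real measure"
  where "estimate n k Q H A = transcript n Q A k \<bind> H"

definition eps_delta_estimator ::
    "real \<Rightarrow> real \<Rightarrow> real mat set \<Rightarrow> nat \<Rightarrow> nat \<Rightarrow>
     (nat \<Rightarrow> history \<Rightarrow> query measure) \<Rightarrow> (history \<Rightarrow> real measure) \<Rightarrow> bool" where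
  "eps_delta_estimator \<epsilon> \<delta> \<A> n k Q H \<longleftrightarrow> trace_estimator n k Q H \<and>
     (\<forall>A\<in>\<A>. measure (estimate n k Q H A) {y. \<bar>mat_trace A - y\<bar> \<le> \<epsilon> * mat_trace A} \<ge> 1 - \<delta>)"

lemma oracle_answer_eq:
  assumes "A \<in> carrier_mat n n"
  shows "oracle_answer n A x = (\<Sum>i<n. \<Sum>j<n. x i * A $$ (i, j) * x j)"
  using assms
  by (auto simp: oracle_answer_def scalar_prod_def sum_distrib_left lessThan_atLeast0 mult.assoc
      intro!: sum.cong)

lemma measurable_oracle_answer [measurable]:
  assumes "A \<in> carrier_mat n n"
  shows "oracle_answer n A \<in> query_space n \<rightarrow>\<^sub>M borel"
  unfolding oracle_answer_eq[OF assms, abs_def] query_space_def by measurable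

lemma transcript_in_prob_algebra:
  assumes A: "A \<in> carrier_mat n n"
    and Q: "\<And>j. j < i \<Longrightarrow> Q j \<in> history_space n j \<rightarrow>\<^sub>M prob_algebra (query_space n)"
  shows "transcript n Q A i \<in> space (prob_algebra (history_space n i))"
  using Q
proof (induction i)
  case 0
  then show ?case
    by (auto simp: space_prob_algebra history_space_def space_PiM intro!: prob_space_return)
next
  case (Suc i)
  have IH: "transcript n Q A i \<in> space (prob_algebra (history_space n i))"
    using Suc by auto
  have [measurable]: "Q i \<in> history_space n i \<rightarrow>\<^sub>M prob_algebra (query_space n)"
    using Suc.prems by auto
  note [measurable] = measurable_oracle_answer[OF A]
  have "(\<lambda>p. (fst p)(i := (snd p, oracle_answer n A (snd p))))
      \<in> history_space n i \<Otimes>\<^sub>M query_space n \<rightarrow>\<^sub>M history_space n (Suc i)"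
    unfolding history_space_def
    by (intro measurable_fun_upd[where J="{..<i}"]) (auto simp flip: history_space_def)
  then have step: "(\<lambda>h. distr (Q i h) (history_space n (Suc i)) (\<lambda>x. h(i := (x, oracle_answer n A x))))
      \<in> history_space n i \<rightarrow>\<^sub>M prob_algebra (history_space n (Suc i))"
    by (intro measurable_distr_prob_space2[where M="query_space n"]) (auto simp: split_beta')
  show ?case
    using prob_space_bind'[OF IH step] sets_bind'[OF IH step] by (simp add: space_prob_algebra)
qed

lemma estimate_in_prob_algebra:
  assumes "trace_estimator n k Q H" "A \<in> carrier_mat n n"
  shows "estimate n k Q H A \<in> space (prob_algebra borel)"
proof -
  have T: "transcript n Q A k \<in> space (prob_algebra (history_space n k))"
    using assms by (intro transcript_in_prob_algebra) (auto simp: trace_estimator_def)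
  have H: "H \<in> history_space n k \<rightarrow>\<^sub>M prob_algebra borel"
    using assms by (simp add: trace_estimator_def)
  show ?thesis
    using prob_space_bind'[OF T H] sets_bind'[OF T H]
    by (simp add: estimate_def space_prob_algebra)
qed

end

theory Submission
  imports Defs
begin

text \<open>
  The hard instances are \<open>A = g g\<^sup>T\<close> with \<open>g \<sim> N(0, s\<^sup>2 I)\<close>. The answer to a query \<open>x\<close> is \<open>\<langle>x, g\<rangle>\<^sup>2\<close>, and
  by rotation invariance only one new Gaussian coordinate of \<open>g\<close> is revealed per query, however
  adaptive the algorithm is. Cauchy-Schwarz, applied once per query, therefore gives
  \<open>P\<^sub>s(E)\<^sup>2 \<le> D\<^sup>k P\<^sub>1(E)\<close> for every event \<open>E\<close> about the output, where
  \<open>D = \<integral> \<phi>\<^sub>s\<^sup>2 / \<phi>\<^sub>1 = (1 - (1 - s\<^sup>2)\<^sup>2) powr (-1/2)\<close> is \<open>exp (O(\<epsilon>\<^sup>2))\<close> if \<open>1 - s\<^sup>2 = O(\<epsilon>)\<close>.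
  The trace \<open>|g|\<^sup>2\<close> concentrates around \<open>n s\<^sup>2\<close>, so for \<open>s\<^sub>j = ((1 - \<epsilon>) / (1 + \<epsilon>))\<^sup>j\<close>, \<open>j = 0, \<dots>, M\<close>, the
  acceptable outputs form disjoint intervals \<open>S\<^sub>j\<close>. For \<open>s = 1\<close> the output misses \<open>S\<^sub>0\<close> with probability
  at most about \<open>\<delta>\<close>, so some \<open>S\<^sub>j\<close> has \<open>P\<^sub>1(S\<^sub>j) \<le> 2 \<delta> / M\<close>, while \<open>P\<^bsub>s\<^sub>j\<^esub>(S\<^sub>j)\<close> is bounded below. With \<open>M\<close> a large
  constant depending on \<open>\<delta>\<^sub>0\<close> this forces \<open>1 / \<delta> \<le> D\<^sup>k\<close>.
\<close>

section \<open>Gaussian expectations along a list of directions\<close>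

abbreviation real_seqs :: "(nat \<Rightarrow> real) measure" where
  "real_seqs \<equiv> \<Pi>\<^sub>M i\<in>UNIV. borel"

text \<open>
  \<open>gauss_expect s cs b f\<close> is the expectation of \<open>f (b + \<Sum>\<^sub>j z\<^sub>j c\<^sub>j)\<close> for \<open>cs = [c\<^sub>1, c\<^sub>2, \<dots>]\<close> and independent
  \<open>z\<^sub>j \<sim> N(0, s\<^sup>2)\<close>. Sequences are indexed by all natural numbers rather than by \<open>{..<n}\<close>, so that
  no extensionality conditions arise; only the first \<open>n\<close> entries ever matter.
\<close>

primrec gauss_expect ::
    "real \<Rightarrow> (nat \<Rightarrow> real) list \<Rightarrow> (nat \<Rightarrow> real) \<Rightarrow> ((nat \<Rightarrow> real) \<Rightarrow> ennreal) \<Rightarrow> ennreal" where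
  "gauss_expect s [] b f = f b"
| "gauss_expect s (c # cs) b f =
     (\<integral>\<^sup>+z. ennreal (normal_density 0 s z) * gauss_expect s cs (\<lambda>i. b i + z * c i) f \<partial>lborel)"

lemma measurable_real_seqs_component: "(\<lambda>b. b i) \<in> real_seqs \<rightarrow>\<^sub>M borel"
  by (rule measurable_component_singleton) simp

lemma measurable_shift:
  assumes "f \<in> N \<rightarrow>\<^sub>M real_seqs" "z \<in> borel_measurable N"
  shows "(\<lambda>y. \<lambda>i. f y i + z y * c i) \<in> N \<rightarrow>\<^sub>M real_seqs"
proof -
  have "(\<lambda>y. f y i) \<in> borel_measurable N" for i
    using measurable_compose[OF assms(1) measurable_real_seqs_component] .
  then show ?thesis
    using assms(2) by (intro measurable_PiM_single') (auto simp: space_PiM)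
qed

text \<open>Each integration moves the base point, so measurability has to be carried jointly in the
  parameter and the base point for the induction to close.\<close>

lemma measurable_gauss_expect_param:
  assumes "(\<lambda>(y, g). f y g) \<in> borel_measurable (N \<Otimes>\<^sub>M real_seqs)"
  shows "(\<lambda>(y, b). gauss_expect s cs b (f y)) \<in> borel_measurable (N \<Otimes>\<^sub>M real_seqs)"
proof (induction cs)
  case Nil
  then show ?case using assms by simp
next
  case (Cons c cs)
  have *: "(\<lambda>p. (fst (fst p), \<lambda>i. snd (fst p) i + snd p * c i))
      \<in> (N \<Otimes>\<^sub>M real_seqs) \<Otimes>\<^sub>M lborel \<rightarrow>\<^sub>M N \<Otimes>\<^sub>M real_seqs"
    by (intro measurable_Pair measurable_shift) measurable
  have [measurable]: "(\<lambda>p. gauss_expect s cs (\<lambda>i. snd (fst p) i + snd p * c i) (f (fst (fst p))))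
      \<in> borel_measurable ((N \<Otimes>\<^sub>M real_seqs) \<Otimes>\<^sub>M lborel)"
    using measurable_compose[OF * Cons.IH] by simp
  have "(\<lambda>q. \<integral>\<^sup>+z. ennreal (normal_density 0 s z) *
        gauss_expect s cs (\<lambda>i. snd q i + z * c i) (f (fst q)) \<partial>lborel)
      \<in> borel_measurable (N \<Otimes>\<^sub>M real_seqs)"
    by (intro lborel.borel_measurable_nn_integral) (simp add: split_beta')
  then show ?case by (simp add: split_beta')
qed

lemma measurable_gauss_expect:
  assumes f: "f \<in> borel_measurable real_seqs"
    and b: "b \<in> N \<rightarrow>\<^sub>M real_seqs"
  shows "(\<lambda>y. gauss_expect s cs (b y) f) \<in> borel_measurable N"
proof -
  have "(\<lambda>(y, g). f g) \<in> borel_measurable (N \<Otimes>\<^sub>M real_seqs)"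
    using measurable_compose[OF measurable_snd f] by (simp add: split_beta')
  from measurable_gauss_expect_param[OF this, of s cs]
  have m: "(\<lambda>(y, b). gauss_expect s cs b f) \<in> borel_measurable (N \<Otimes>\<^sub>M real_seqs)" .
  have "(\<lambda>y. (y, b y)) \<in> N \<rightarrow>\<^sub>M N \<Otimes>\<^sub>M real_seqs"
    using b by measurable
  from measurable_compose[OF this m] show ?thesis by simp
qed

lemma measurable_gauss_expect_line:
  assumes "f \<in> borel_measurable real_seqs"
  shows "(\<lambda>z. gauss_expect s cs (\<lambda>i. b i + z * c i) f) \<in> borel_measurable borel"
  using assms by (intro measurable_gauss_expect measurable_shift) (auto simp: space_PiM)

lemma nn_integral_normal_density: "0 < s \<Longrightarrow> (\<integral>\<^sup>+z. ennreal (normal_density m s z) \<partial>lborel) = 1"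
  using prob_space.emeasure_space_1[OF prob_space_normal_density, of s m]
  by (simp add: emeasure_density)

lemma gauss_expect_const: "0 < s \<Longrightarrow> gauss_expect s cs b (\<lambda>_. a) = a"
  by (induction cs arbitrary: b) (auto simp: nn_integral_multc nn_integral_normal_density)

lemma gauss_expect_mono: "(\<And>g. f g \<le> f' g) \<Longrightarrow> gauss_expect s cs b f \<le> gauss_expect s cs b f'"
  by (induction cs arbitrary: b) (auto intro!: nn_integral_mono mult_left_mono)

lemma gauss_expect_add:
  assumes [measurable]: "f \<in> borel_measurable real_seqs" "f' \<in> borel_measurable real_seqs"
  shows "gauss_expect s cs b (\<lambda>g. f g + f' g) = gauss_expect s cs b f + gauss_expect s cs b f'"
proof (induction cs arbitrary: b)
  case (Cons c cs)
  show ?case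
    using measurable_gauss_expect_line[OF assms(1)] measurable_gauss_expect_line[OF assms(2)]
    by (simp add: Cons.IH distrib_left nn_integral_add)
qed simp

lemma gauss_expect_cmult:
  assumes [measurable]: "f \<in> borel_measurable real_seqs"
  shows "gauss_expect s cs b (\<lambda>g. a * f g) = a * gauss_expect s cs b f"
proof (induction cs arbitrary: b)
  case (Cons c cs)
  show ?case
    using measurable_gauss_expect_line[OF assms(1)]
    by (simp add: Cons.IH nn_integral_cmult[symmetric] mult.left_commute)
qed simp

lemma gauss_expect_sum:
  assumes "finite J" "\<And>j. j \<in> J \<Longrightarrow> f j \<in> borel_measurable real_seqs" "0 < s"
  shows "gauss_expect s cs b (\<lambda>g. \<Sum>j\<in>J. f j g) = (\<Sum>j\<in>J. gauss_expect s cs b (f j))"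
  using assms(1,2) by (induction J) (auto simp: gauss_expect_const assms(3) gauss_expect_add)

text \<open>Tonelli, once per direction. It exchanges the randomness of a query with that of the
  Gaussian vector, so that the directions can later be adapted to a fixed query.\<close>

lemma gauss_expect_nn_integral:
  assumes "sigma_finite_measure N"
    and f: "(\<lambda>(y, g). f y g) \<in> borel_measurable (N \<Otimes>\<^sub>M real_seqs)"
  shows "gauss_expect s cs b (\<lambda>g. \<integral>\<^sup>+y. f y g \<partial>N) = (\<integral>\<^sup>+y. gauss_expect s cs b (f y) \<partial>N)"
proof (induction cs arbitrary: b)
  case (Cons c cs)
  interpret N: sigma_finite_measure N by fact
  interpret pair_sigma_finite lborel N ..
  have *: "(\<lambda>p. (snd p, \<lambda>i. b i + fst p * c i)) \<in> lborel \<Otimes>\<^sub>M N \<rightarrow>\<^sub>M N \<Otimes>\<^sub>M real_seqs"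
    by (intro measurable_Pair measurable_shift) (auto simp: space_PiM)
  have m [measurable]: "(\<lambda>p. gauss_expect s cs (\<lambda>i. b i + fst p * c i) (f (snd p)))
      \<in> borel_measurable (lborel \<Otimes>\<^sub>M N)"
    using measurable_compose[OF * measurable_gauss_expect_param[OF f]] by simp
  have "(\<integral>\<^sup>+z. ennreal (normal_density 0 s z) *
      (\<integral>\<^sup>+y. gauss_expect s cs (\<lambda>i. b i + z * c i) (f y) \<partial>N) \<partial>lborel) =
    (\<integral>\<^sup>+z. (\<integral>\<^sup>+y. ennreal (normal_density 0 s z) *
      gauss_expect s cs (\<lambda>i. b i + z * c i) (f y) \<partial>N) \<partial>lborel)"
    using measurable_Pair2[OF m] by (intro nn_integral_cong nn_integral_cmult[symmetric]) auto
  also have "\<dots> = (\<integral>\<^sup>+y. (\<integral>\<^sup>+z. ennreal (normal_density 0 s z) *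
      gauss_expect s cs (\<lambda>i. b i + z * c i) (f y) \<partial>lborel) \<partial>N)"
    by (rule Fubini'[symmetric]) (simp add: split_beta')
  finally show ?case by (simp add: Cons.IH)
qed simp

subsection \<open>Rotation invariance\<close>

lemma measurable_binary:
  assumes "(\<lambda>p. F (fst p) (snd p)) \<in> borel_measurable (borel \<Otimes>\<^sub>M borel)"
    and "f \<in> borel_measurable M" "g \<in> borel_measurable M"
  shows "(\<lambda>x. F (f x) (g x)) \<in> borel_measurable M"
  using measurable_compose[OF measurable_Pair[OF assms(2,3)] assms(1)] by simp

text \<open>Tonelli for the two outermost coordinates. In the alignment below it takes the place of
  the quarter turn, which the condition \<open>a \<noteq> 0\<close> excludes from
  \<open>gauss_expect_rotation\<close>.\<close>

lemma gauss_expect_swap: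
  assumes "f \<in> borel_measurable real_seqs"
  shows "gauss_expect s (c # d # cs) b f = gauss_expect s (d # c # cs) b f"
proof -
  define F where "F x y = gauss_expect s cs (\<lambda>i. b i + x * c i + y * d i) f" for x y
  have F: "(\<lambda>p. F (fst p) (snd p)) \<in> borel_measurable (borel \<Otimes>\<^sub>M borel)"
    unfolding F_def using assms
    by (intro measurable_gauss_expect measurable_shift) (auto simp: space_PiM)
  have [measurable]: "F x \<in> borel_measurable borel" for x
    unfolding F_def using measurable_gauss_expect_line[OF assms] .
  have [measurable]: "(\<lambda>x. F x y) \<in> borel_measurable borel" for y
    unfolding F_def using measurable_gauss_expect_line[OF assms, of s cs "\<lambda>i. b i + y * d i" c]
    by (simp add: ac_simps)
  let ?n = "\<lambda>z. ennreal (normal_density 0 s z)"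
  have "gauss_expect s (c # d # cs) b f = (\<integral>\<^sup>+x. (\<integral>\<^sup>+y. ?n x * (?n y * F x y) \<partial>lborel) \<partial>lborel)"
    by (simp add: F_def[symmetric] nn_integral_cmult)
  also have "\<dots> = (\<integral>\<^sup>+y. (\<integral>\<^sup>+x. ?n x * (?n y * F x y) \<partial>lborel) \<partial>lborel)"
    by (rule lborel_pair.Fubini')
      (auto intro!: borel_measurable_times_ennreal measurable_binary[OF F] simp: split_beta')
  also have "\<dots> = (\<integral>\<^sup>+y. ?n y * (\<integral>\<^sup>+x. ?n x * F x y \<partial>lborel) \<partial>lborel)"
    by (simp add: nn_integral_cmult[symmetric] mult.left_commute)
  also have "\<dots> = gauss_expect s (d # c # cs) b f"
    by (simp add: F_def ac_simps)
  finally show ?thesis .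
qed

text \<open>For \<open>a \<noteq> 0\<close> the rotation factors into two one-dimensional affine substitutions.\<close>

lemma nn_integral_rotation:
  fixes F :: "real \<Rightarrow> real \<Rightarrow> ennreal"
  assumes [measurable]: "(\<lambda>p. F (fst p) (snd p)) \<in> borel_measurable (borel \<Otimes>\<^sub>M borel)"
    and ab: "a\<^sup>2 + \<beta>\<^sup>2 = 1" "a \<noteq> 0"
  shows "(\<integral>\<^sup>+x. \<integral>\<^sup>+y. F (a * x - \<beta> * y) (\<beta> * x + a * y) \<partial>lborel \<partial>lborel) =
    (\<integral>\<^sup>+x. \<integral>\<^sup>+y. F x y \<partial>lborel \<partial>lborel)"
proof -
  note mF = measurable_binary[OF assms(1)]
  \<comment> \<open>After substituting \<open>- (\<beta> / a) * x + (1 / a) * y\<close> for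
    \<open>y\<close>, the second argument of \<open>F\<close> is \<open>y\<close> itself and only
    the first still depends on \<open>x\<close>.\<close>
  have e1: "a * x - \<beta> * (- (\<beta> / a) * x + (1 / a) * y) = x / a - \<beta> / a * y" for x y
  proof -
    have "a * x - \<beta> * (- (\<beta> / a) * x + (1 / a) * y) = (a\<^sup>2 + \<beta>\<^sup>2) * x / a - \<beta> / a * y"
      using ab(2) by (simp add: field_simps power2_eq_square)
    then show ?thesis using ab(1) by simp
  qed
  have e2: "\<beta> * x + a * (- (\<beta> / a) * x + (1 / a) * y) = y" for x y
    using ab(2) by (simp add: field_simps)
  have "(\<integral>\<^sup>+x. \<integral>\<^sup>+y. F (a * x - \<beta> * y) (\<beta> * x + a * y) \<partial>lborel \<partial>lborel) =
    (\<integral>\<^sup>+x. ennreal \<bar>1 / a\<bar> * (\<integral>\<^sup>+y. F (x / a - \<beta> / a * y) y \<partial>lborel) \<partial>lborel)"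
  proof (intro nn_integral_cong)
    fix x
    have "(\<integral>\<^sup>+y. F (a * x - \<beta> * y) (\<beta> * x + a * y) \<partial>lborel) =
      ennreal \<bar>1 / a\<bar> * (\<integral>\<^sup>+y. F (a * x - \<beta> * (- (\<beta> / a) * x + (1 / a) * y))
        (\<beta> * x + a * (- (\<beta> / a) * x + (1 / a) * y)) \<partial>lborel)"
      by (rule nn_integral_real_affine[OF mF]) (use ab in auto)
    then show "(\<integral>\<^sup>+y. F (a * x - \<beta> * y) (\<beta> * x + a * y) \<partial>lborel) =
      ennreal \<bar>1 / a\<bar> * (\<integral>\<^sup>+y. F (x / a - \<beta> / a * y) y \<partial>lborel)"
      unfolding e1 e2 .
  qed
  also have "\<dots> = (\<integral>\<^sup>+x. (\<integral>\<^sup>+y. ennreal \<bar>1 / a\<bar> * F (x / a - \<beta> / a * y) y \<partial>lborel) \<partial>lborel)"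
    by (intro nn_integral_cong nn_integral_cmult[symmetric]) (auto intro!: mF)
  also have "\<dots> = (\<integral>\<^sup>+y. (\<integral>\<^sup>+x. ennreal \<bar>1 / a\<bar> * F (x / a - \<beta> / a * y) y \<partial>lborel) \<partial>lborel)"
    by (rule lborel_pair.Fubini') (auto intro!: mF borel_measurable_times_ennreal simp: split_beta')
  \<comment> \<open>With \<open>y\<close> fixed, an affine substitution in \<open>x\<close> uses up
    the Jacobian factor \<open>\<bar>1 / a\<bar>\<close>.\<close>
  also have "\<dots> = (\<integral>\<^sup>+y. (\<integral>\<^sup>+x. F x y \<partial>lborel) \<partial>lborel)"
  proof (rule nn_integral_cong)
    fix y
    have "(\<integral>\<^sup>+x. F x y \<partial>lborel) = ennreal \<bar>1 / a\<bar> * (\<integral>\<^sup>+x. F (- (\<beta> / a * y) + (1 / a) * x) y \<partial>lborel)"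
      by (rule nn_integral_real_affine[OF mF]) (use ab in auto)
    also have "\<dots> = (\<integral>\<^sup>+x. ennreal \<bar>1 / a\<bar> * F (- (\<beta> / a * y) + (1 / a) * x) y \<partial>lborel)"
      by (intro nn_integral_cmult[symmetric]) (auto intro!: mF)
    finally show "(\<integral>\<^sup>+x. ennreal \<bar>1 / a\<bar> * F (x / a - \<beta> / a * y) y \<partial>lborel) = (\<integral>\<^sup>+x. F x y \<partial>lborel)"
      by simp
  qed
  also have "\<dots> = (\<integral>\<^sup>+x. \<integral>\<^sup>+y. F x y \<partial>lborel \<partial>lborel)"
    by (rule lborel_pair.Fubini') (auto intro!: mF simp: split_beta')
  finally show ?thesis .
qed

lemma normal_density_rotation:
  assumes "a\<^sup>2 + \<beta>\<^sup>2 = 1"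
  shows "normal_density 0 s (a * x - \<beta> * y) * normal_density 0 s (\<beta> * x + a * y) =
    normal_density 0 s x * normal_density 0 s y"
proof -
  have "(a * x - \<beta> * y)\<^sup>2 + (\<beta> * x + a * y)\<^sup>2 = (a\<^sup>2 + \<beta>\<^sup>2) * (x\<^sup>2 + y\<^sup>2)"
    by (simp add: power2_eq_square algebra_simps)
  then have "- (a * x - \<beta> * y)\<^sup>2 / (2 * s\<^sup>2) + - (\<beta> * x + a * y)\<^sup>2 / (2 * s\<^sup>2) =
      - x\<^sup>2 / (2 * s\<^sup>2) + - y\<^sup>2 / (2 * s\<^sup>2)"
    using assms unfolding add_divide_distrib[symmetric] by simp
  then have "exp (- (a * x - \<beta> * y)\<^sup>2 / (2 * s\<^sup>2)) * exp (- (\<beta> * x + a * y)\<^sup>2 / (2 * s\<^sup>2)) =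
      exp (- x\<^sup>2 / (2 * s\<^sup>2)) * exp (- y\<^sup>2 / (2 * s\<^sup>2))"
    unfolding exp_add[symmetric] by simp
  then show ?thesis
    by (simp add: normal_density_def)
qed

text \<open>Rotating the pair of coefficients leaves their joint density unchanged, since x^2 + y^2
  is preserved; collecting the coefficients of x and y then gives the new directions.\<close>

lemma gauss_expect_rotation:
  assumes f: "f \<in> borel_measurable real_seqs" and ab: "a\<^sup>2 + \<beta>\<^sup>2 = 1" "a \<noteq> 0"
  shows "gauss_expect s (c # d # cs) b f =
    gauss_expect s ((\<lambda>i. a * c i + \<beta> * d i) # (\<lambda>i. a * d i - \<beta> * c i) # cs) b f"
proof -
  define G where "G x y = gauss_expect s cs (\<lambda>i. b i + x * c i + y * d i) f" for x y
  define F where "F x y = ennreal (normal_density 0 s x * normal_density 0 s y) * G x y" for x y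
  have G: "(\<lambda>p. G (fst p) (snd p)) \<in> borel_measurable (borel \<Otimes>\<^sub>M borel)"
    unfolding G_def using f
    by (intro measurable_gauss_expect measurable_shift) (auto simp: space_PiM)
  then have F: "(\<lambda>p. F (fst p) (snd p)) \<in> borel_measurable (borel \<Otimes>\<^sub>M borel)"
    unfolding F_def by measurable
  have expand: "gauss_expect s (c' # d' # cs) b f = (\<integral>\<^sup>+x. (\<integral>\<^sup>+y.
      ennreal (normal_density 0 s x * normal_density 0 s y) *
      gauss_expect s cs (\<lambda>i. b i + x * c' i + y * d' i) f \<partial>lborel) \<partial>lborel)" for c' d'
    using measurable_gauss_expect_line[OF f]
    by (simp add: nn_integral_cmult[symmetric] ennreal_mult mult.assoc)
  have "gauss_expect s (c # d # cs) b f = (\<integral>\<^sup>+x. \<integral>\<^sup>+y. F x y \<partial>lborel \<partial>lborel)"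
    by (simp only: expand F_def G_def)
  also have "\<dots> = (\<integral>\<^sup>+x. \<integral>\<^sup>+y. F (a * x - \<beta> * y) (\<beta> * x + a * y) \<partial>lborel \<partial>lborel)"
    by (rule nn_integral_rotation[OF F ab, symmetric])
  also have "\<dots> = gauss_expect s ((\<lambda>i. a * c i + \<beta> * d i) # (\<lambda>i. a * d i - \<beta> * c i) # cs) b f"
    unfolding expand F_def G_def normal_density_rotation[OF ab(1)]
    by (simp add: algebra_simps)
  finally show ?thesis .
qed

definition dot :: "nat \<Rightarrow> (nat \<Rightarrow> real) \<Rightarrow> (nat \<Rightarrow> real) \<Rightarrow> real" where
  "dot n x g = (\<Sum>i<n. x i * g i)"

lemma dot_add: "dot n x (\<lambda>i. g i + z * c i) = dot n x g + z * dot n x c"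
  by (simp add: dot_def sum.distrib sum_distrib_left algebra_simps)

lemma dot_comb: "dot n x (\<lambda>i. u * g i - z * c i) = u * dot n x g - z * dot n x c"
  by (simp add: dot_def sum_subtractf sum_distrib_left algebra_simps)

text \<open>
  Any family of directions can be rotated so that a query \<open>x\<close> sees only the first one; the new
  directions depend neither on \<open>s\<close> nor on the integrand.
\<close>

lemma gauss_expect_align:
  "\<exists>c cs'. (\<forall>d\<in>set cs'. dot n x d = 0) \<and>
    (\<forall>s b. \<forall>f\<in>borel_measurable real_seqs. gauss_expect s (d # cs) b f = gauss_expect s (c # cs') b f)"
proof (induction cs arbitrary: d)
  case Nil
  then show ?case by (intro exI[of _ d] exI[of _ "[]"]) simp
next
  case (Cons e cs)
  obtain c cs' where cs': "\<forall>d\<in>set cs'. dot n x d = 0"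
    and eq: "\<And>s b f. f \<in> borel_measurable real_seqs \<Longrightarrow>
      gauss_expect s (e # cs) b f = gauss_expect s (c # cs') b f"
    using Cons.IH[of e] by blast
  have eq': "gauss_expect s (d # e # cs) b f = gauss_expect s (d # c # cs') b f"
    if "f \<in> borel_measurable real_seqs" for s b f
    using eq[OF that, of s] by (simp only: gauss_expect.simps(2)[of s d])
  show ?case
  proof (cases "dot n x d = 0")
    \<comment> \<open>Here \<open>d\<close> is already orthogonal to \<open>x\<close>, so it
      suffices to bring \<open>c\<close> to the front.\<close>
    case True
    then show ?thesis
      using cs' eq' gauss_expect_swap[of _ _ d c cs']
      by (intro exI[of _ c] exI[of _ "d # cs'"]) simp_all
  next
    case False
    define r where "r = sqrt ((dot n x d)\<^sup>2 + (dot n x c)\<^sup>2)"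
    have "0 < (dot n x d)\<^sup>2 + (dot n x c)\<^sup>2"
      using False by (simp add: sum_power2_gt_zero_iff)
    then have r: "r\<^sup>2 = (dot n x d)\<^sup>2 + (dot n x c)\<^sup>2" "r \<noteq> 0"
      by (auto simp: r_def)
    \<comment> \<open>This angle makes the second rotated direction,
      \<open>a * c i - \<beta> * d i\<close>, orthogonal to \<open>x\<close>.\<close>
    define a \<beta> where "a = dot n x d / r" and "\<beta> = dot n x c / r"
    have ab: "a\<^sup>2 + \<beta>\<^sup>2 = 1" "a \<noteq> 0"
      using r False by (simp_all add: a_def \<beta>_def power_divide add_divide_distrib[symmetric])
    have "dot n x (\<lambda>i. a * c i - \<beta> * d i) = 0"
      unfolding dot_comb by (simp add: a_def \<beta>_def)
    then show ?thesis
      using cs' eq' gauss_expect_rotation[OF _ ab, of _ _ d c cs']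
      by (intro exI[of _ "\<lambda>i. a * d i + \<beta> * c i"] exI[of _ "(\<lambda>i. a * c i - \<beta> * d i) # cs'"])
        (simp_all del: gauss_expect.simps)
  qed
qed

text \<open>Moving along directions orthogonal to \<open>x\<close> keeps \<open>dot n x\<close> at
  its value in \<open>b\<close>. This freezes the answer to the query \<open>x\<close> while the
  remaining coordinates are integrated.\<close>

lemma gauss_expect_cong_dot:
  assumes "\<forall>d\<in>set cs. dot n x d = 0" "\<And>g. dot n x g = dot n x b \<Longrightarrow> f g = f' g"
  shows "gauss_expect s cs b f = gauss_expect s cs b f'"
  using assms
proof (induction cs arbitrary: b)
  case (Cons c cs)
  then have "gauss_expect s cs (\<lambda>i. b i + z * c i) f = gauss_expect s cs (\<lambda>i. b i + z * c i) f'" for z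
    by (intro Cons.IH) (auto simp: dot_add)
  then show ?case by simp
qed simp

subsection \<open>Change of scale along an adaptive sequence of queries\<close>

text \<open>The quotient of the squared density by the standard one is a multiple of a centred
  Gaussian density of variance s^2 / (2 - s^2), because 1 / s^2 - 1 / 2 = (2 - s^2) / (2 s^2). The
  factor is the second moment, under N(0, 1), of the likelihood ratio of N(0, s^2) to N(0,
  1).\<close>

lemma normal_density_sq_eq:
  assumes "0 < s" "s\<^sup>2 < 2"
  shows "(normal_density 0 s z)\<^sup>2 =
    1 / sqrt (s\<^sup>2 * (2 - s\<^sup>2)) * normal_density 0 (s / sqrt (2 - s\<^sup>2)) z * normal_density 0 1 z"
proof -
  define q where "q = sqrt (2 - s\<^sup>2)"
  have q: "0 < q" "q\<^sup>2 = 2 - s\<^sup>2" using assms by (simp_all add: q_def)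
  have "2 * (- z\<^sup>2 / (2 * s\<^sup>2)) = - (z\<^sup>2 * (q\<^sup>2 + s\<^sup>2)) / (2 * s\<^sup>2)"
    using q(2) by (simp add: mult.commute)
  also have "\<dots> = - z\<^sup>2 / (2 * (s / q)\<^sup>2) + - z\<^sup>2 / 2"
    using q(1) assms(1) by (simp add: power_divide field_simps)
  finally have e: "2 * (- z\<^sup>2 / (2 * s\<^sup>2)) = - z\<^sup>2 / (2 * (s / q)\<^sup>2) + - z\<^sup>2 / 2" .
  have 1: "(exp (- z\<^sup>2 / (2 * s\<^sup>2)))\<^sup>2 = exp (- z\<^sup>2 / (2 * (s / q)\<^sup>2)) * exp (- z\<^sup>2 / 2)"
    unfolding exp_add[symmetric] e[symmetric] by (rule exp_double[symmetric])
  have "sqrt (s\<^sup>2 * (2 - s\<^sup>2)) = s * q" "sqrt (2 * pi * (s / q)\<^sup>2) = sqrt (2 * pi) * (s / q)"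
    using assms(1) q(1) by (simp_all add: q_def real_sqrt_mult real_sqrt_divide power_divide)
  then have 2: "(1 / sqrt (2 * pi * s\<^sup>2))\<^sup>2 =
      1 / sqrt (s\<^sup>2 * (2 - s\<^sup>2)) * (1 / sqrt (2 * pi * (s / q)\<^sup>2)) * (1 / sqrt (2 * pi))"
    using assms(1) q(1) by (simp add: power_divide power2_eq_square)
  show ?thesis
    unfolding normal_density_def q_def[symmetric] diff_zero power_mult_distrib 1 2
    by (simp add: mult.assoc mult.left_commute)
qed

text \<open>The density of N(0, s^2) is split as (its quotient by the root of the standard density)
  times (that root). The first factor, squared, integrates to the constant of
  \<open>normal_density_sq_eq\<close>; the second goes with \<open>u\<close>.\<close>

lemma gaussian_Cauchy_Schwarz:
  assumes "0 < s" "s\<^sup>2 < 2" and [measurable]: "u \<in> borel_measurable borel"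
  shows "(\<integral>\<^sup>+z. ennreal (normal_density 0 s z) * u z \<partial>lborel)\<^sup>2 \<le>
    ennreal (1 / sqrt (s\<^sup>2 * (2 - s\<^sup>2))) * (\<integral>\<^sup>+z. ennreal (normal_density 0 1 z) * (u z)\<^sup>2 \<partial>lborel)"
proof -
  define D where "D = 1 / sqrt (s\<^sup>2 * (2 - s\<^sup>2))"
  have D: "0 \<le> D" using assms by (simp add: D_def)
  define t where "t = s / sqrt (2 - s\<^sup>2)"
  have t: "0 < t" using assms by (simp add: t_def)
  define v where "v z = ennreal (sqrt (D * normal_density 0 t z))" for z
  define w where "w z = ennreal (sqrt (normal_density 0 1 z)) * u z" for z
  have [measurable]: "v \<in> borel_measurable lborel" "w \<in> borel_measurable lborel"
    unfolding v_def w_def by measurable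
  have vw: "ennreal (normal_density 0 s z) * u z = v z * w z" for z
  proof -
    have "normal_density 0 s z = sqrt ((normal_density 0 s z)\<^sup>2)"
      by simp
    also have "\<dots> = sqrt (D * normal_density 0 t z) * sqrt (normal_density 0 1 z)"
      unfolding normal_density_sq_eq[OF assms(1,2)] D_def t_def real_sqrt_mult by simp
    finally have "ennreal (normal_density 0 s z) =
        ennreal (sqrt (D * normal_density 0 t z)) * ennreal (sqrt (normal_density 0 1 z))"
      using D by (simp add: ennreal_mult)
    then show ?thesis
      unfolding v_def w_def by (simp only: mult.assoc)
  qed
  have v2: "(v z)\<^sup>2 = ennreal D * ennreal (normal_density 0 t z)" for z
    using D by (simp add: v_def ennreal_power ennreal_mult)
  have w2: "(w z)\<^sup>2 = ennreal (normal_density 0 1 z) * (u z)\<^sup>2" for z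
    by (simp add: w_def power_mult_distrib ennreal_power)
  have "(\<integral>\<^sup>+z. v z * w z \<partial>lborel)\<^sup>2 \<le> (\<integral>\<^sup>+z. (v z)\<^sup>2 \<partial>lborel) * (\<integral>\<^sup>+z. (w z)\<^sup>2 \<partial>lborel)"
    by (rule Cauchy_Schwarz_nn_integral) auto
  also have "(\<integral>\<^sup>+z. (v z)\<^sup>2 \<partial>lborel) = ennreal D"
    unfolding v2 by (simp add: nn_integral_cmult nn_integral_normal_density[OF t])
  finally show ?thesis
    unfolding vw w2 D_def .
qed

section \<open>Expected payoffs of adaptive queries\<close>

lemma (in prob_space) nn_integral_square_le:
  assumes [measurable]: "u \<in> borel_measurable M"
  shows "(\<integral>\<^sup>+x. u x \<partial>M)\<^sup>2 \<le> (\<integral>\<^sup>+x. (u x)\<^sup>2 \<partial>M)"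
  using Cauchy_Schwarz_nn_integral[of "\<lambda>_. 1" M u] by (simp add: emeasure_space_1)

text \<open>
  \<open>payoff n Q F m i h g\<close> is the expectation of \<open>F\<close> at the final history when \<open>m\<close> further queries to the
  matrix \<open>g g\<^sup>T\<close> follow a history \<open>h\<close> of length \<open>i\<close>. It peels queries from the front, whereas
  \<^const>\<open>transcript\<close> appends them at the end.
\<close>

primrec payoff ::
    "nat \<Rightarrow> (nat \<Rightarrow> history \<Rightarrow> query measure) \<Rightarrow> (history \<Rightarrow> ennreal) \<Rightarrow> nat \<Rightarrow> nat \<Rightarrow>
      history \<Rightarrow> (nat \<Rightarrow> real) \<Rightarrow> ennreal" where
  "payoff n Q F 0 i h g = F h"
| "payoff n Q F (Suc m) i h g =
     (\<integral>\<^sup>+x. payoff n Q F m (Suc i) (h(i := (x, (dot n x g)\<^sup>2))) g \<partial>Q i h)"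

lemma measurable_dot [measurable]: "(\<lambda>(x, g). dot n x g) \<in> borel_measurable (query_space n \<Otimes>\<^sub>M real_seqs)"
proof -
  have "(\<lambda>p. fst p i) \<in> borel_measurable (query_space n \<Otimes>\<^sub>M real_seqs)" if "i < n" for i
    using that unfolding query_space_def
    by (intro measurable_compose[OF measurable_fst measurable_component_singleton]) simp
  moreover have "(\<lambda>p. snd p i) \<in> borel_measurable (query_space n \<Otimes>\<^sub>M real_seqs)" for i
    by (rule measurable_compose[OF measurable_snd measurable_real_seqs_component])
  ultimately show ?thesis
    unfolding dot_def split_beta' by (intro borel_measurable_sum borel_measurable_times) auto
qed

lemma measurable_extend_history:
  assumes "h \<in> N \<rightarrow>\<^sub>M history_space n i" "x \<in> N \<rightarrow>\<^sub>M query_space n" "r \<in> borel_measurable N"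
  shows "(\<lambda>p. (h p)(i := (x p, r p))) \<in> N \<rightarrow>\<^sub>M history_space n (Suc i)"
  using assms unfolding history_space_def
  by (intro measurable_fun_upd[where J="{..<i}"]) auto

text \<open>\<open>F\<close> will be the probability that the output kernel puts into a fixed set.
  Its bound by 1 gives F^2 \<le> F, the base case of \<open>gauss_expect_payoff_le\<close>.\<close>

locale adaptive_queries =
  fixes n k :: nat and Q :: "nat \<Rightarrow> history \<Rightarrow> query measure" and F :: "history \<Rightarrow> ennreal"
  assumes Q: "\<And>i. i < k \<Longrightarrow> Q i \<in> history_space n i \<rightarrow>\<^sub>M prob_algebra (query_space n)"
    and F: "F \<in> borel_measurable (history_space n k)"
    and F_le: "\<And>h. h \<in> space (history_space n k) \<Longrightarrow> F h \<le> 1"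
begin

abbreviation "W \<equiv> payoff n Q F"

lemma prob_space_Q: "i < k \<Longrightarrow> h \<in> space (history_space n i) \<Longrightarrow> prob_space (Q i h)"
  and sets_Q: "i < k \<Longrightarrow> h \<in> space (history_space n i) \<Longrightarrow> sets (Q i h) = sets (query_space n)"
  using measurable_space[OF Q] by (auto simp: space_prob_algebra)

lemma extend_history:
  "h \<in> space (history_space n i) \<Longrightarrow> x \<in> space (query_space n) \<Longrightarrow>
    h(i := (x, r)) \<in> space (history_space n (Suc i))"
  by (auto simp: history_space_def space_PiM space_pair_measure PiE_def extensional_def Pi_def)

lemma payoff_le_1:
  "i + m = k \<Longrightarrow> h \<in> space (history_space n i) \<Longrightarrow> W m i h g \<le> 1"
proof (induction m arbitrary: i h)
  case (Suc m)
  then have i: "i < k" by simp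
  interpret prob_space "Q i h" using prob_space_Q i Suc.prems by blast
  have "W m (Suc i) (h(i := (x, (dot n x g)\<^sup>2))) g \<le> 1" if "x \<in> space (Q i h)" for x
    using that Suc.prems sets_eq_imp_space_eq[OF sets_Q[OF i Suc.prems(2)]]
    by (intro Suc.IH extend_history) auto
  then have "W (Suc m) i h g \<le> (\<integral>\<^sup>+x. 1 \<partial>Q i h)"
    unfolding payoff.simps by (rule nn_integral_mono)
  then show ?case by (simp add: emeasure_space_1)
qed (simp add: F_le)

lemma measurable_payoff:
  "i + m = k \<Longrightarrow> (\<lambda>(h, g). W m i h g) \<in> borel_measurable (history_space n i \<Otimes>\<^sub>M real_seqs)"
proof (induction m arbitrary: i)
  case 0
  then show ?case
    using measurable_compose[OF measurable_fst F] by (simp add: split_beta')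
next
  case (Suc m)
  let ?N = "history_space n i \<Otimes>\<^sub>M real_seqs"
  have i: "i < k" using Suc.prems by simp
  have L: "(\<lambda>p. Q i (fst p)) \<in> ?N \<rightarrow>\<^sub>M subprob_algebra (query_space n)"
    using measurable_compose[OF measurable_fst measurable_prob_algebraD[OF Q[OF i]]] .
  have d: "(\<lambda>q. (dot n (snd q) (snd (fst q)))\<^sup>2) \<in> borel_measurable (?N \<Otimes>\<^sub>M query_space n)"
    using measurable_compose[OF measurable_Pair[OF measurable_snd
        measurable_compose[OF measurable_fst measurable_snd]] measurable_dot]
    by simp
  have e: "(\<lambda>q. ((fst (fst q))(i := (snd q, (dot n (snd q) (snd (fst q)))\<^sup>2)), snd (fst q)))
      \<in> ?N \<Otimes>\<^sub>M query_space n \<rightarrow>\<^sub>M history_space n (Suc i) \<Otimes>\<^sub>M real_seqs"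
    by (intro measurable_Pair measurable_extend_history d) measurable
  have "(\<lambda>(p, x). W m (Suc i) ((fst p)(i := (x, (dot n x (snd p))\<^sup>2))) (snd p))
      \<in> borel_measurable (?N \<Otimes>\<^sub>M query_space n)"
    using measurable_compose[OF e Suc.IH[of "Suc i"]] Suc.prems by (simp add: split_beta')
  from nn_integral_measurable_subprob_algebra2[OF this L] show ?case
    by (simp add: split_beta')
qed

text \<open>Induction on the number of remaining queries. Jensen moves the square inside the random
  choice of the query x. Once the directions are aligned with x, the answer depends on the first
  coordinate z alone, so Cauchy-Schwarz in z costs one factor \<open>D\<close>; for each z the
  induction hypothesis applies to the remaining directions and a shifted base point.\<close>

lemma gauss_expect_payoff_le:
  assumes s: "0 < s" "s\<^sup>2 < 2"
  defines "D \<equiv> ennreal (1 / sqrt (s\<^sup>2 * (2 - s\<^sup>2)))"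
  shows "i + m = k \<Longrightarrow> h \<in> space (history_space n i) \<Longrightarrow>
    (gauss_expect s cs b (W m i h))\<^sup>2 \<le> D ^ m * gauss_expect 1 cs b (W m i h)"
proof (induction m arbitrary: i h cs b)
  case 0
  have "(F h)\<^sup>2 \<le> F h"
    using mult_right_mono[OF F_le[of h], of "F h"] 0 by (simp add: power2_eq_square)
  then show ?case by (simp add: gauss_expect_const s)
next
  case (Suc m)
  have i: "i < k" using Suc.prems by simp
  interpret prob_space "Q i h" using prob_space_Q i Suc.prems by blast
  note [measurable_cong] = sets_Q[OF i Suc.prems(2)]
  have spQ: "space (Q i h) = space (query_space n)"
    using sets_eq_imp_space_eq[OF sets_Q[OF i Suc.prems(2)]] .
  have D1: "1 \<le> D"
  proof -
    have "s\<^sup>2 * (2 - s\<^sup>2) = 1 - (1 - s\<^sup>2)\<^sup>2" by (simp add: power2_eq_square algebra_simps)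
    then have "s\<^sup>2 * (2 - s\<^sup>2) \<le> 1" by simp
    then show ?thesis using s by (simp add: D_def)
  qed
  define P where "P x g = W m (Suc i) (h(i := (x, (dot n x g)\<^sup>2))) g" for x g
  have "(\<lambda>q. (h(i := (fst q, (dot n (fst q) (snd q))\<^sup>2)), snd q))
      \<in> query_space n \<Otimes>\<^sub>M real_seqs \<rightarrow>\<^sub>M history_space n (Suc i) \<Otimes>\<^sub>M real_seqs"
    using Suc.prems(2) measurable_dot[of n]
    by (intro measurable_Pair measurable_extend_history borel_measurable_power)
      (auto simp: split_beta')
  from measurable_compose[OF this measurable_payoff[of "Suc i" m]]
  have mP: "(\<lambda>(x, g). P x g) \<in> borel_measurable (query_space n \<Otimes>\<^sub>M real_seqs)"
    using Suc.prems(1) by (simp add: P_def split_beta')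
  then have mPQ: "(\<lambda>(x, g). P x g) \<in> borel_measurable (Q i h \<Otimes>\<^sub>M real_seqs)"
    by measurable
  \<comment> \<open>Given the history, the law of the query does not depend on the hidden vector, so
    its expectation can be taken outermost.\<close>
  have Wf: "gauss_expect s' cs b (W (Suc m) i h) = (\<integral>\<^sup>+x. gauss_expect s' cs b (P x) \<partial>Q i h)" for s'
  proof -
    have "W (Suc m) i h = (\<lambda>g. \<integral>\<^sup>+x. P x g \<partial>Q i h)"
      by (simp add: fun_eq_iff P_def)
    then show ?thesis
      using gauss_expect_nn_integral[OF sigma_finite_measure mPQ, of s' cs b] by simp
  qed
  have mG: "(\<lambda>x. gauss_expect s' cs b (P x)) \<in> borel_measurable (Q i h)" for s'
    using measurable_Pair1[OF measurable_gauss_expect_param[OF mPQ, of s' cs], of b]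
    by (simp add: space_PiM)
  have step: "(gauss_expect s cs b (P x))\<^sup>2 \<le> D ^ Suc m * gauss_expect 1 cs b (P x)"
    if "x \<in> space (query_space n)" for x
  proof (cases cs)
    \<comment> \<open>No randomness of the hidden vector is left. The payoff is at most 1, so its
      square is at most itself, and the powers of \<open>D \<ge> 1\<close> are given away.\<close>
    case Nil
    have "P x b \<le> 1"
      unfolding P_def using Suc.prems that by (intro payoff_le_1 extend_history) auto
    moreover have "1 \<le> D ^ Suc m" using D1 by (rule one_le_power)
    ultimately have "P x b * P x b \<le> D ^ Suc m * P x b"
      by (intro mult_right_mono) auto
    then show ?thesis using Nil by (simp add: power2_eq_square)
  next
    case (Cons d cs0)
    obtain c cs' where cs': "\<forall>d\<in>set cs'. dot n x d = 0"
      and eq: "\<And>s b f. f \<in> borel_measurable real_seqs \<Longrightarrow>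
        gauss_expect s (d # cs0) b f = gauss_expect s (c # cs') b f"
      using gauss_expect_align[of n x d cs0] by blast
    have mPx: "P x \<in> borel_measurable real_seqs"
      using measurable_Pair2[OF mP that] by simp
    \<comment> \<open>For fixed \<open>z\<close> the query leads to this single history, whatever
      the coordinates along \<open>cs'\<close> are.\<close>
    define h' where "h' z = h(i := (x, (dot n x (\<lambda>j. b j + z * c j))\<^sup>2))" for z
    have h': "h' z \<in> space (history_space n (Suc i))" for z
      unfolding h'_def using Suc.prems that by (intro extend_history) auto
    have cong: "gauss_expect s' cs' (\<lambda>j. b j + z * c j) (P x) =
        gauss_expect s' cs' (\<lambda>j. b j + z * c j) (W m (Suc i) (h' z))" for s' z
      by (rule gauss_expect_cong_dot[OF cs']) (simp add: P_def h'_def)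
    define u where "u s' z = gauss_expect s' cs' (\<lambda>j. b j + z * c j) (P x)" for s' z
    have [measurable]: "u s' \<in> borel_measurable borel" for s'
      unfolding u_def by (rule measurable_gauss_expect_line[OF mPx])
    have u: "gauss_expect s' cs b (P x) = (\<integral>\<^sup>+z. ennreal (normal_density 0 s' z) * u s' z \<partial>lborel)" for s'
      unfolding Cons eq[OF mPx] u_def by simp
    have IH: "(u s z)\<^sup>2 \<le> D ^ m * u 1 z" for z
      unfolding u_def cong using Suc.prems(1) by (intro Suc.IH h') simp
    have "(gauss_expect s cs b (P x))\<^sup>2 \<le>
        D * (\<integral>\<^sup>+z. ennreal (normal_density 0 1 z) * (u s z)\<^sup>2 \<partial>lborel)"
      unfolding u D_def by (rule gaussian_Cauchy_Schwarz[OF s]) simp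
    also have "\<dots> \<le> D * (\<integral>\<^sup>+z. ennreal (normal_density 0 1 z) * (D ^ m * u 1 z) \<partial>lborel)"
      by (intro mult_left_mono nn_integral_mono IH) auto
    also have "\<dots> = D ^ Suc m * gauss_expect 1 cs b (P x)"
      unfolding u by (simp add: nn_integral_cmult[symmetric] mult.left_commute mult.assoc)
    finally show ?thesis .
  qed
  have "(gauss_expect s cs b (W (Suc m) i h))\<^sup>2 \<le> (\<integral>\<^sup>+x. (gauss_expect s cs b (P x))\<^sup>2 \<partial>Q i h)"
    unfolding Wf by (rule nn_integral_square_le[OF mG])
  also have "\<dots> \<le> (\<integral>\<^sup>+x. D ^ Suc m * gauss_expect 1 cs b (P x) \<partial>Q i h)"
    using step by (intro nn_integral_mono) (simp add: spQ)
  also have "\<dots> = D ^ Suc m * gauss_expect 1 cs b (W (Suc m) i h)"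
    unfolding Wf by (rule nn_integral_cmult[OF mG])
  finally show ?case .
qed

end

subsection \<open>Concentration of the trace\<close>

text \<open>The second and fourth moments of N(0, s^2) are s^2 and 3 s^4. The summand
  \<open>v\<close> carries the variance already collected from other coordinates.\<close>

lemma normal_density_quartic:
  assumes "0 < s" "0 \<le> v"
  shows "(\<integral>\<^sup>+z. ennreal (normal_density 0 s z) * ennreal ((a + z\<^sup>2)\<^sup>2 + v) \<partial>lborel) =
    ennreal ((a + s\<^sup>2)\<^sup>2 + 2 * s^4 + v)"
proof -
  have h: "has_bochner_integral lborel
      (\<lambda>z. normal_density 0 s z * (z - 0) ^ (2 * 2) +
        (2 * a) * (normal_density 0 s z * (z - 0) ^ (2 * 1)) +
        (a\<^sup>2 + v) * (normal_density 0 s z * (z - 0) ^ (2 * 0)))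
      (fact (2 * 2) / ((2 / s\<^sup>2) ^ 2 * fact 2) + (2 * a) * (fact (2 * 1) / ((2 / s\<^sup>2) ^ 1 * fact 1)) +
        (a\<^sup>2 + v) * (fact (2 * 0) / ((2 / s\<^sup>2) ^ 0 * fact 0)))"
    by (intro has_bochner_integral_add has_bochner_integral_mult_right normal_moment_even assms(1))
  have f: "(\<lambda>z. normal_density 0 s z * (z - 0) ^ (2 * 2) +
        (2 * a) * (normal_density 0 s z * (z - 0) ^ (2 * 1)) +
        (a\<^sup>2 + v) * (normal_density 0 s z * (z - 0) ^ (2 * 0))) =
      (\<lambda>z. normal_density 0 s z * ((a + z\<^sup>2)\<^sup>2 + v))"
    by (simp add: fun_eq_iff power2_eq_square power4_eq_xxxx algebra_simps)
  have e: "fact (2 * 2) / ((2 / s\<^sup>2) ^ 2 * fact 2) + (2 * a) * (fact (2 * 1) / ((2 / s\<^sup>2) ^ 1 * fact 1)) +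
        (a\<^sup>2 + v) * (fact (2 * 0) / ((2 / s\<^sup>2) ^ 0 * fact 0)) = (a + s\<^sup>2)\<^sup>2 + 2 * s^4 + v"
    using assms by (simp add: fact_numeral power_divide field_simps power2_eq_square power4_eq_xxxx)
  from h[unfolded f e] have "has_bochner_integral lborel (\<lambda>z. normal_density 0 s z * ((a + z\<^sup>2)\<^sup>2 + v))
      ((a + s\<^sup>2)\<^sup>2 + 2 * s^4 + v)" .
  then have "(\<integral>\<^sup>+z. ennreal (normal_density 0 s z * ((a + z\<^sup>2)\<^sup>2 + v)) \<partial>lborel) =
      ennreal ((a + s\<^sup>2)\<^sup>2 + 2 * s^4 + v)"
    using assms(2) by (subst nn_integral_eq_integral) (auto simp: has_bochner_integral_iff)
  then show ?thesis using assms(2) by (simp add: ennreal_mult)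
qed

definition unit_seq :: "nat \<Rightarrow> nat \<Rightarrow> real" where
  "unit_seq j i = (if i = j then 1 else 0)"

lemma dot_self_add_unit_seq:
  assumes "j < n" "b j = 0"
  shows "dot n (\<lambda>i. b i + z * unit_seq j i) (\<lambda>i. b i + z * unit_seq j i) = dot n b b + z\<^sup>2"
proof -
  have "(b i + z * unit_seq j i) * (b i + z * unit_seq j i) = b i * b i + (if i = j then z\<^sup>2 else 0)" for i
    using assms(2) by (simp add: unit_seq_def power2_eq_square)
  then show ?thesis
    using assms(1) by (simp add: dot_def sum.distrib)
qed

text \<open>Squared bias plus variance: each coordinate direction adds s^2 to the mean of the
  squared norm and 2 s^4 to its variance.\<close>

lemma gauss_expect_sq_deviation:
  assumes "0 < s" "distinct js" "set js \<subseteq> {..<n}" "\<And>j. j \<in> set js \<Longrightarrow> b j = 0"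
  shows "gauss_expect s (map unit_seq js) b (\<lambda>g. ennreal ((dot n g g - t)\<^sup>2)) =
    ennreal ((dot n b b + real (length js) * s\<^sup>2 - t)\<^sup>2 + 2 * real (length js) * s^4)"
  using assms(2-4)
proof (induction js arbitrary: b)
  case (Cons j js)
  let ?m = "real (length js)"
  have "gauss_expect s (map unit_seq js) (\<lambda>i. b i + z * unit_seq j i) (\<lambda>g. ennreal ((dot n g g - t)\<^sup>2)) =
      ennreal (((dot n b b + ?m * s\<^sup>2 - t) + z\<^sup>2)\<^sup>2 + 2 * ?m * s^4)" for z
  proof -
    have "b j = 0" using Cons.prems by simp
    then have "dot n (\<lambda>i. b i + z * unit_seq j i) (\<lambda>i. b i + z * unit_seq j i) = dot n b b + z\<^sup>2"
      using Cons.prems by (intro dot_self_add_unit_seq) auto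
    then show ?thesis
      using Cons.prems by (subst Cons.IH) (auto simp: unit_seq_def algebra_simps)
  qed
  then have "gauss_expect s (map unit_seq (j # js)) b (\<lambda>g. ennreal ((dot n g g - t)\<^sup>2)) =
    ennreal (((dot n b b + ?m * s\<^sup>2 - t) + s\<^sup>2)\<^sup>2 + 2 * s^4 + 2 * ?m * s^4)"
    by (simp add: normal_density_quartic[OF assms(1)] del: ennreal_plus)
  then show ?case by (simp add: algebra_simps)
qed simp

abbreviation iid_normal :: "nat \<Rightarrow> real \<Rightarrow> ((nat \<Rightarrow> real) \<Rightarrow> ennreal) \<Rightarrow> ennreal" where
  "iid_normal n s f \<equiv> gauss_expect s (map unit_seq [0..<n]) (\<lambda>_. 0) f"

lemma measurable_dot_self: "(\<lambda>g. dot n g g) \<in> borel_measurable real_seqs"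
  unfolding dot_def
  by (intro borel_measurable_sum borel_measurable_times measurable_real_seqs_component)

text \<open>Chebyshev's inequality, with variance 2 n s^4 and deviation \<tau> n s^2.\<close>

lemma iid_normal_norm_concentration:
  assumes s: "0 < s" and \<tau>: "0 < \<tau>" and n: "0 < n"
  shows "iid_normal n s (indicator {g. \<tau> * (real n * s\<^sup>2) < \<bar>dot n g g - real n * s\<^sup>2\<bar>}) \<le>
    ennreal (2 / (\<tau>\<^sup>2 * real n))"
proof -
  let ?t = "real n * s\<^sup>2"
  have pos: "0 < \<tau> * ?t" using assms by simp
  have m: "(\<lambda>g. ennreal ((dot n g g - ?t)\<^sup>2)) \<in> borel_measurable real_seqs"
    using measurable_dot_self[of n] by measurable
  have "indicator {g. \<tau> * ?t < \<bar>dot n g g - ?t\<bar>} g \<le>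
      ennreal (1 / (\<tau> * ?t)\<^sup>2) * ennreal ((dot n g g - ?t)\<^sup>2)" for g
  proof (cases "\<tau> * ?t < \<bar>dot n g g - ?t\<bar>")
    case True
    then have "(\<tau> * ?t)\<^sup>2 \<le> (dot n g g - ?t)\<^sup>2"
      using pos by (intro abs_le_square_iff[THEN iffD1]) simp
    moreover have "0 < (\<tau> * ?t)\<^sup>2" using pos by (rule zero_less_power)
    ultimately have "1 \<le> 1 / (\<tau> * ?t)\<^sup>2 * (dot n g g - ?t)\<^sup>2"
      by (simp add: le_divide_eq_1_pos del: power_mult_distrib)
    with True show ?thesis
      by (simp add: ennreal_mult[symmetric] del: times_divide_eq_left)
  qed simp
  then have "iid_normal n s (indicator {g. \<tau> * ?t < \<bar>dot n g g - ?t\<bar>}) \<le>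
      iid_normal n s (\<lambda>g. ennreal (1 / (\<tau> * ?t)\<^sup>2) * ennreal ((dot n g g - ?t)\<^sup>2))"
    by (rule gauss_expect_mono)
  also have "\<dots> = ennreal (1 / (\<tau> * ?t)\<^sup>2) * ennreal (2 * real n * s^4)"
    unfolding gauss_expect_cmult[OF m]
    by (subst gauss_expect_sq_deviation) (auto simp: s dot_def)
  also have "\<dots> = ennreal (1 / (\<tau> * ?t)\<^sup>2 * (2 * real n * s^4))"
    by (rule ennreal_mult[symmetric]) auto
  also have "1 / (\<tau> * ?t)\<^sup>2 * (2 * real n * s^4) = 2 / (\<tau>\<^sup>2 * real n)"
    using assms by (simp add: power_mult_distrib power2_eq_square power4_eq_xxxx)
  finally show ?thesis .
qed

subsection \<open>Rank-one instances\<close>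

definition outer_square :: "nat \<Rightarrow> (nat \<Rightarrow> real) \<Rightarrow> real mat" where
  "outer_square n g = mat n n (\<lambda>(i, j). g i * g j)"

lemma outer_square_carrier [simp]: "outer_square n g \<in> carrier_mat n n"
  by (simp add: outer_square_def)

lemma mat_trace_outer_square: "mat_trace (outer_square n g) = dot n g g"
  by (simp add: mat_trace_def outer_square_def dot_def)

lemma oracle_answer_outer_square: "oracle_answer n (outer_square n g) x = (dot n x g)\<^sup>2"
proof -
  have "oracle_answer n (outer_square n g) x = (\<Sum>i<n. \<Sum>j<n. (x i * g i) * (x j * g j))"
    unfolding oracle_answer_eq[OF outer_square_carrier]
    by (intro sum.cong) (auto simp: outer_square_def)
  then show ?thesis by (simp add: dot_def power2_eq_square sum_product)
qed

lemma outer_square_psd: "outer_square n g \<in> psd_matrices n"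
proof -
  have "0 \<le> scalar_prod v (outer_square n g *\<^sub>v v)" if v: "v \<in> carrier_vec n" for v
  proof -
    have "vec n (vec_index v) = v" using v by auto
    then show ?thesis
      using oracle_answer_outer_square[of n g "vec_index v"] by (simp add: oracle_answer_def)
  qed
  moreover have "transpose_mat (outer_square n g) = outer_square n g"
    by (auto simp: outer_square_def mult.commute)
  ultimately show ?thesis by (simp add: psd_matrices_def)
qed

context adaptive_queries
begin

text \<open>The left side does not depend on \<open>i\<close>: the last query of the transcript can
  be moved to the front of the payoff. At \<open>i = k\<close> it is the expectation of
  \<open>F\<close> over the complete transcript, which reconciles the two recursions.\<close>

lemma nn_integral_payoff_transcript:
  "i + m = k \<Longrightarrow> (\<integral>\<^sup>+h. W m i h g \<partial>transcript n Q (outer_square n g) i) = W k 0 (\<lambda>_. undefined) g"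
proof (induction i arbitrary: m)
  case 0
  have u: "(\<lambda>_. undefined) \<in> space (history_space n 0)"
    by (simp add: history_space_def space_PiM)
  have "(\<lambda>h. W k 0 h g) \<in> borel_measurable (history_space n 0)"
    using measurable_Pair1[OF measurable_payoff[of 0 k]] by (simp add: space_PiM)
  with 0 u show ?case by (simp add: nn_integral_return)
next
  case (Suc i)
  let ?A = "outer_square n g"
  have i: "i < k" using Suc.prems by simp
  have T: "transcript n Q ?A i \<in> space (prob_algebra (history_space n i))"
    using i Q by (intro transcript_in_prob_algebra) auto
  then have sT: "sets (transcript n Q ?A i) = sets (history_space n i)"
    by (simp add: space_prob_algebra)
  have mW: "(\<lambda>h. W m (Suc i) h g) \<in> borel_measurable (history_space n (Suc i))"
    using measurable_Pair1[OF measurable_payoff[of "Suc i" m]] Suc.prems by (simp add: space_PiM)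
  have d: "(\<lambda>x. (dot n x g)\<^sup>2) \<in> borel_measurable (query_space n)"
    using measurable_Pair1[OF measurable_dot, of g] by (simp add: space_PiM)
  have d2: "(\<lambda>p. (dot n (snd p) g)\<^sup>2) \<in> borel_measurable (history_space n i \<Otimes>\<^sub>M query_space n)"
    using measurable_compose[OF measurable_snd d] .
  have "(\<lambda>p. (fst p)(i := (snd p, (dot n (snd p) g)\<^sup>2)))
      \<in> history_space n i \<Otimes>\<^sub>M query_space n \<rightarrow>\<^sub>M history_space n (Suc i)"
    by (intro measurable_extend_history d2) auto
  then have "(\<lambda>h. distr (Q i h) (history_space n (Suc i)) (\<lambda>x. h(i := (x, oracle_answer n ?A x))))
      \<in> history_space n i \<rightarrow>\<^sub>M prob_algebra (history_space n (Suc i))"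
    unfolding oracle_answer_outer_square
    by (intro measurable_distr_prob_space2[OF Q[OF i]]) (simp add: split_beta')
  then have K: "(\<lambda>h. distr (Q i h) (history_space n (Suc i)) (\<lambda>x. h(i := (x, oracle_answer n ?A x))))
      \<in> transcript n Q ?A i \<rightarrow>\<^sub>M subprob_algebra (history_space n (Suc i))"
    using measurable_prob_algebraD measurable_cong_sets[OF sT refl] by blast
  have "(\<integral>\<^sup>+h. W m (Suc i) h g \<partial>transcript n Q ?A (Suc i)) =
    (\<integral>\<^sup>+h. (\<integral>\<^sup>+h'. W m (Suc i) h' g \<partial>distr (Q i h) (history_space n (Suc i))
      (\<lambda>x. h(i := (x, oracle_answer n ?A x)))) \<partial>transcript n Q ?A i)"
    unfolding transcript.simps by (rule nn_integral_bind[OF mW K])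
  also have "\<dots> = (\<integral>\<^sup>+h. W (Suc m) i h g \<partial>transcript n Q ?A i)"
  proof (rule nn_integral_cong)
    fix h assume "h \<in> space (transcript n Q ?A i)"
    then have h: "h \<in> space (history_space n i)"
      using sets_eq_imp_space_eq[OF sT] by simp
    have "(\<lambda>x. h(i := (x, (dot n x g)\<^sup>2))) \<in> query_space n \<rightarrow>\<^sub>M history_space n (Suc i)"
      using h by (intro measurable_extend_history d) auto
    then have "(\<lambda>x. h(i := (x, (dot n x g)\<^sup>2))) \<in> Q i h \<rightarrow>\<^sub>M history_space n (Suc i)"
      using measurable_cong_sets[OF sets_Q[OF i h] refl] by blast
    then show "(\<integral>\<^sup>+h'. W m (Suc i) h' g \<partial>distr (Q i h) (history_space n (Suc i))
        (\<lambda>x. h(i := (x, oracle_answer n ?A x)))) = W (Suc m) i h g"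
      unfolding oracle_answer_outer_square by (subst nn_integral_distr) (simp_all add: mW)
  qed
  also have "\<dots> = W k 0 (\<lambda>_. undefined) g"
    using Suc.prems by (intro Suc.IH) simp
  finally show ?case .
qed

end

section \<open>Hit probabilities averaged over the random instances\<close>

definition hit_prob ::
    "nat \<Rightarrow> nat \<Rightarrow> (nat \<Rightarrow> history \<Rightarrow> query measure) \<Rightarrow> (history \<Rightarrow> real measure) \<Rightarrow>
      real set \<Rightarrow> (nat \<Rightarrow> real) \<Rightarrow> ennreal" where
  "hit_prob n k Q H S g = emeasure (estimate n k Q H (outer_square n g)) S"

lemma adaptive_queries_emeasure:
  assumes "trace_estimator n k Q H" "S \<in> sets borel"
  shows "adaptive_queries n k Q (\<lambda>h. emeasure (H h) S)"
proof
  show "i < k \<Longrightarrow> Q i \<in> history_space n i \<rightarrow>\<^sub>M prob_algebra (query_space n)" for i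
    using assms by (simp add: trace_estimator_def)
  have H: "H \<in> history_space n k \<rightarrow>\<^sub>M prob_algebra borel"
    using assms by (simp add: trace_estimator_def)
  show "(\<lambda>h. emeasure (H h) S) \<in> borel_measurable (history_space n k)"
    using measurable_compose[OF measurable_prob_algebraD[OF H] measurable_emeasure_subprob_algebra]
      assms(2) by blast
  fix h assume "h \<in> space (history_space n k)"
  then have "prob_space (H h)"
    using measurable_space[OF H] by (simp add: space_prob_algebra)
  then show "emeasure (H h) S \<le> 1"
    by (rule prob_space.measure_le_1)
qed

lemma hit_prob_eq_payoff:
  assumes "trace_estimator n k Q H" "S \<in> sets borel"
  shows "hit_prob n k Q H S = payoff n Q (\<lambda>h. emeasure (H h) S) k 0 (\<lambda>_. undefined)"
proof
  fix g
  interpret adaptive_queries n k Q "\<lambda>h. emeasure (H h) S"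
    using adaptive_queries_emeasure[OF assms] .
  have T: "transcript n Q (outer_square n g) k \<in> space (prob_algebra (history_space n k))"
    using Q by (intro transcript_in_prob_algebra) auto
  then have sT: "sets (transcript n Q (outer_square n g) k) = sets (history_space n k)"
    and pT: "prob_space (transcript n Q (outer_square n g) k)"
    by (simp_all add: space_prob_algebra)
  have "H \<in> history_space n k \<rightarrow>\<^sub>M subprob_algebra borel"
    using assms(1) by (intro measurable_prob_algebraD) (simp add: trace_estimator_def)
  then have H: "H \<in> transcript n Q (outer_square n g) k \<rightarrow>\<^sub>M subprob_algebra borel"
    using measurable_cong_sets[OF sT refl] by blast
  show "hit_prob n k Q H S g = payoff n Q (\<lambda>h. emeasure (H h) S) k 0 (\<lambda>_. undefined) g"
    using nn_integral_payoff_transcript[of k 0 g]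
      emeasure_bind[OF prob_space.not_empty[OF pT] H assms(2)]
    by (simp add: hit_prob_def estimate_def)
qed

lemma hit_prob_le_1:
  assumes "trace_estimator n k Q H"
  shows "hit_prob n k Q H S g \<le> 1"
  using estimate_in_prob_algebra[OF assms outer_square_carrier]
  by (auto simp: hit_prob_def space_prob_algebra intro: prob_space.measure_le_1)

lemma undefined_in_history_space_0: "(\<lambda>_. undefined) \<in> space (history_space n 0)"
  by (simp add: history_space_def space_PiM)

lemma measurable_hit_prob:
  assumes "trace_estimator n k Q H" "S \<in> sets borel"
  shows "hit_prob n k Q H S \<in> borel_measurable real_seqs"
proof -
  interpret adaptive_queries n k Q "\<lambda>h. emeasure (H h) S"
    using adaptive_queries_emeasure[OF assms] .
  show ?thesis
    using measurable_Pair2[OF measurable_payoff[of 0 k] undefined_in_history_space_0]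
    by (simp add: hit_prob_eq_payoff[OF assms])
qed

text \<open>The change of scale over a full run: the Cauchy-Schwarz factor is paid once per query,
  whatever the dimension and the set.\<close>

lemma iid_normal_hit_prob_le:
  assumes "trace_estimator n k Q H" "S \<in> sets borel" "0 < s" "s\<^sup>2 < 2"
  shows "(iid_normal n s (hit_prob n k Q H S))\<^sup>2 \<le>
    ennreal (1 / sqrt (s\<^sup>2 * (2 - s\<^sup>2))) ^ k * iid_normal n 1 (hit_prob n k Q H S)"
proof -
  interpret adaptive_queries n k Q "\<lambda>h. emeasure (H h) S"
    using adaptive_queries_emeasure[OF assms(1,2)] .
  show ?thesis
    unfolding hit_prob_eq_payoff[OF assms(1,2)]
    by (rule gauss_expect_payoff_le[OF assms(3,4) _ undefined_in_history_space_0]) simp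
qed

text \<open>A union bound: unless the squared norm is atypical (Chebyshev) or the estimator fails
  (probability at most \<delta> for each instance), \<open>hit\<close> forces the output into
  \<open>S\<close>. The bound is stated as a sum because subtraction is truncated in
  \<open>ennreal\<close>.\<close>

lemma iid_normal_hit_prob_ge:
  assumes E: "eps_delta_estimator \<epsilon> \<delta> (psd_matrices n) n k Q H" and "0 \<le> \<delta>"
    and "0 < s" "0 < \<tau>" "0 < n" and S: "S \<in> sets borel"
    and hit: "\<And>T y. \<bar>T - real n * s\<^sup>2\<bar> \<le> \<tau> * (real n * s\<^sup>2) \<Longrightarrow> \<bar>T - y\<bar> \<le> \<epsilon> * T \<Longrightarrow> y \<in> S"
  shows "1 \<le> iid_normal n s (hit_prob n k Q H S) + ennreal (\<delta> + 2 / (\<tau>\<^sup>2 * real n))"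
proof -
  have te: "trace_estimator n k Q H" using E by (simp add: eps_delta_estimator_def)
  let ?B = "{g. \<tau> * (real n * s\<^sup>2) < \<bar>dot n g g - real n * s\<^sup>2\<bar>}"
  have mB: "(indicator ?B :: _ \<Rightarrow> ennreal) \<in> borel_measurable real_seqs"
  proof -
    have "{g \<in> space real_seqs. \<tau> * (real n * s\<^sup>2) < \<bar>dot n g g - real n * s\<^sup>2\<bar>} \<in> sets real_seqs"
      using measurable_dot_self[of n] by measurable
    then show ?thesis by (intro borel_measurable_indicator) (simp add: space_PiM)
  qed
  have "1 \<le> hit_prob n k Q H S g + (ennreal \<delta> + indicator ?B g)" for g
  proof (cases "g \<in> ?B")
    case True
    then show ?thesis by (simp add: add_increasing)
  next
    case False
    let ?A = "outer_square n g"
    let ?E = "estimate n k Q H ?A"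
    have pe: "prob_space ?E" "sets ?E = sets borel"
      using estimate_in_prob_algebra[OF te outer_square_carrier] by (auto simp: space_prob_algebra)
    interpret prob_space ?E by (rule pe)
    let ?T = "dot n g g"
    have "1 - \<delta> \<le> measure ?E {y. \<bar>?T - y\<bar> \<le> \<epsilon> * ?T}"
      using E outer_square_psd[of n g] by (auto simp: eps_delta_estimator_def mat_trace_outer_square)
    also have "\<dots> \<le> measure ?E S"
      using False S hit[of ?T] pe(2) by (intro finite_measure_mono) auto
    finally have "1 - \<delta> \<le> measure ?E S" .
    then have "ennreal 1 \<le> ennreal (measure ?E S + \<delta>)" by (intro ennreal_leI) simp
    also have "\<dots> = hit_prob n k Q H S g + ennreal \<delta>"
      using assms(2) by (simp add: hit_prob_def emeasure_eq_measure)
    finally show ?thesis using False by simp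
  qed
  then have "iid_normal n s (\<lambda>_. 1) \<le> iid_normal n s (\<lambda>g. hit_prob n k Q H S g + (ennreal \<delta> + indicator ?B g))"
    by (rule gauss_expect_mono)
  also have "\<dots> = iid_normal n s (hit_prob n k Q H S) + (ennreal \<delta> + iid_normal n s (indicator ?B))"
    using mB
    by (simp add: gauss_expect_add[OF measurable_hit_prob[OF te S]] gauss_expect_add[OF _ mB]
        gauss_expect_const[OF assms(3)])
  also have "\<dots> \<le> iid_normal n s (hit_prob n k Q H S) + (ennreal \<delta> + ennreal (2 / (\<tau>\<^sup>2 * real n)))"
    using iid_normal_norm_concentration[OF assms(3-5)] by (intro add_left_mono)
  finally show ?thesis
    using assms(2) by (simp add: gauss_expect_const assms(3))
qed

text \<open>For each fixed instance the output law is additive on disjoint sets and has mass 1;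
  averaging over the instances preserves the bound.\<close>

lemma sum_iid_normal_hit_prob_le_1:
  assumes te: "trace_estimator n k Q H" and S: "\<And>j. j \<in> J \<Longrightarrow> S j \<in> sets borel"
    and "finite J" "disjoint_family_on S J" "0 < s"
  shows "(\<Sum>j\<in>J. iid_normal n s (hit_prob n k Q H (S j))) \<le> 1"
proof -
  have "(\<Sum>j\<in>J. hit_prob n k Q H (S j) g) \<le> 1" for g
  proof -
    have "sets (estimate n k Q H (outer_square n g)) = sets borel"
      using estimate_in_prob_algebra[OF te outer_square_carrier] by (auto simp: space_prob_algebra)
    then have "(\<Sum>j\<in>J. hit_prob n k Q H (S j) g) = hit_prob n k Q H (\<Union>j\<in>J. S j) g"
      unfolding hit_prob_def using S assms by (intro sum_emeasure) auto
    then show ?thesis using hit_prob_le_1[OF te] by simp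
  qed
  then have "iid_normal n s (\<lambda>g. \<Sum>j\<in>J. hit_prob n k Q H (S j) g) \<le> iid_normal n s (\<lambda>_. 1)"
    by (rule gauss_expect_mono)
  then show ?thesis
    using assms measurable_hit_prob[OF te S] by (simp add: gauss_expect_sum gauss_expect_const)
qed

subsection \<open>The lower bound\<close>

text \<open>Pigeonhole over the scales 0 to \<open>M\<close>, with scale 0 as reference.
  \<open>D\<close> bounds the Cauchy-Schwarz factor at every other scale, and \<eta> absorbs the
  Chebyshev error of the squared norm.\<close>

lemma estimator_query_inequality:
  assumes E: "eps_delta_estimator \<epsilon> \<delta> (psd_matrices n) n k Q H"
    and \<epsilon>: "0 < \<epsilon>" "\<epsilon> < 1" and \<delta>: "0 \<le> \<delta>" and n: "0 < n"
    and \<eta>: "8 / (\<epsilon>\<^sup>2 * real n) \<le> \<eta>" "\<delta> + \<eta> \<le> 1" and M: "0 < M"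
    and D: "\<And>j. j \<in> {1..M} \<Longrightarrow>
      1 / sqrt (((1 - \<epsilon>) / (1 + \<epsilon>)) ^ (2 * j) * (2 - ((1 - \<epsilon>) / (1 + \<epsilon>)) ^ (2 * j))) \<le> D"
  shows "(1 - \<delta> - \<eta>)\<^sup>2 \<le> D ^ k * ((\<delta> + \<eta>) / real M)"
proof -
  have te: "trace_estimator n k Q H" using E by (simp add: eps_delta_estimator_def)
  define r where "r = (1 - \<epsilon>) / (1 + \<epsilon>)"
  have r: "0 < r" "r < 1" using \<epsilon> by (simp_all add: r_def)
  define s where "s j = r ^ j" for j :: nat
  have s: "0 < s j" "s j \<le> 1" for j using r by (simp_all add: s_def power_le_one)
  have s2: "(s j)\<^sup>2 = r ^ (2 * j)" for j by (simp add: s_def power_mult mult.commute[of 2])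
  have "s j ^ 2 \<le> 1" for j using s[of j] by (intro power_le_one) auto
  then have s_lt: "(s j)\<^sup>2 < 2" for j by (rule le_less_trans) simp
  \<comment> \<open>The tolerance for the trace itself: below \<epsilon>, so that the intervals
    \<open>S j\<close> stay disjoint. Half of \<epsilon> turns the Chebyshev bound into
    \<open>8 / (\<epsilon>\<^sup>2 * real n)\<close>.\<close>
  define \<tau> where "\<tau> = \<epsilon> / 2"
  have \<tau>: "0 < \<tau>" "\<tau> < \<epsilon>" "\<tau> < 1" using \<epsilon> by (simp_all add: \<tau>_def)
  define S where "S j = {(1 - \<epsilon>) * ((1 - \<tau>) * (real n * (s j)\<^sup>2)) .. (1 + \<epsilon>) * ((1 + \<tau>) * (real n * (s j)\<^sup>2))}" for j
  have mS: "S j \<in> sets borel" for j by (simp add: S_def)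
  have hit: "y \<in> S j" if T: "\<bar>T - real n * (s j)\<^sup>2\<bar> \<le> \<tau> * (real n * (s j)\<^sup>2)" and y: "\<bar>T - y\<bar> \<le> \<epsilon> * T"
    for T y j
  proof -
    have "(1 - \<tau>) * (real n * (s j)\<^sup>2) \<le> T" "T \<le> (1 + \<tau>) * (real n * (s j)\<^sup>2)"
      using T by (simp_all add: abs_le_iff algebra_simps)
    then have "(1 - \<epsilon>) * ((1 - \<tau>) * (real n * (s j)\<^sup>2)) \<le> (1 - \<epsilon>) * T"
      "(1 + \<epsilon>) * T \<le> (1 + \<epsilon>) * ((1 + \<tau>) * (real n * (s j)\<^sup>2))"
      using \<epsilon> by (intro mult_left_mono; simp)+
    moreover have "(1 - \<epsilon>) * T \<le> y" "y \<le> (1 + \<epsilon>) * T"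
      using y by (simp_all add: abs_le_iff algebra_simps)
    ultimately show ?thesis by (simp add: S_def)
  qed
  have disj: "S i \<inter> S j = {}" if "i < j" for i j
  proof -
    \<comment> \<open>The squared scales shrink by at least r^2 from \<open>i\<close> to
      \<open>j\<close>: one factor r turns 1 + \<epsilon> into 1 - \<epsilon>, the other brings 1 +
      \<tau> below 1 - \<tau>.\<close>
    have "s j \<le> s (Suc i)" using that r unfolding s_def by (intro power_decreasing) auto
    then have "(s j)\<^sup>2 \<le> (s (Suc i))\<^sup>2" using s(1)[of j] by (intro power_mono) auto
    also have "\<dots> = r\<^sup>2 * (s i)\<^sup>2" by (simp add: s_def power_mult_distrib)
    finally have "(1 + \<epsilon>) * (1 + \<tau>) * (s j)\<^sup>2 \<le> (1 + \<epsilon>) * (1 + \<tau>) * (r\<^sup>2 * (s i)\<^sup>2)"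
      using \<epsilon> \<tau> by (intro mult_left_mono) auto
    also have "\<dots> = (1 + \<epsilon>) * r * ((1 + \<tau>) * r) * (s i)\<^sup>2"
      by (simp add: power2_eq_square)
    also have "(1 + \<epsilon>) * r = 1 - \<epsilon>" using \<epsilon> by (simp add: r_def)
    also have "(1 - \<epsilon>) * ((1 + \<tau>) * r) * (s i)\<^sup>2 < (1 - \<epsilon>) * (1 - \<tau>) * (s i)\<^sup>2"
    proof -
      have "(1 + \<tau>) * (1 - \<epsilon>) < (1 - \<tau>) * (1 + \<epsilon>)"
        using \<tau> by (simp add: algebra_simps)
      then have "(1 + \<tau>) * r < 1 - \<tau>"
        using \<epsilon> by (simp add: r_def divide_less_eq)
      then show ?thesis using \<epsilon> s(1)[of i] by simp
    qed
    finally have "real n * ((1 + \<epsilon>) * (1 + \<tau>) * (s j)\<^sup>2) < real n * ((1 - \<epsilon>) * (1 - \<tau>) * (s i)\<^sup>2)"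
      using n by simp
    then show ?thesis by (auto simp: S_def algebra_simps)
  qed
  have dS: "disjoint_family_on S {0..M}"
    unfolding disjoint_family_on_def
    by (metis disj Int_commute linorder_neqE_nat)
  define p where "p t j = enn2real (iid_normal n t (hit_prob n k Q H (S j)))" for t j
  have "iid_normal n t (hit_prob n k Q H (S j)) \<le> 1" if "0 < t" for t j
    using gauss_expect_mono[where f="hit_prob n k Q H (S j)" and f'="\<lambda>_. 1", OF hit_prob_le_1[OF te]]
    by (metis gauss_expect_const that)
  then have p: "iid_normal n t (hit_prob n k Q H (S j)) = ennreal (p t j)" if "0 < t" for t j
    unfolding p_def using that
    by (metis ennreal_enn2real ennreal_one_less_top order_le_less_trans)
  have p0: "0 \<le> p t j" for t j by (simp add: p_def)
  have ge: "1 - \<delta> - \<eta> \<le> p (s j) j" for j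
  proof -
    have "2 / (\<tau>\<^sup>2 * real n) = 8 / (\<epsilon>\<^sup>2 * real n)" by (simp add: \<tau>_def power_divide)
    then have "ennreal 1 \<le> ennreal (p (s j) j) + ennreal (\<delta> + 8 / (\<epsilon>\<^sup>2 * real n))"
      using iid_normal_hit_prob_ge[OF E \<delta> s(1)[of j] \<tau>(1) n mS[of j] hit[of _ j]]
      unfolding p[OF s(1)] by simp
    also have "\<dots> = ennreal (p (s j) j + (\<delta> + 8 / (\<epsilon>\<^sup>2 * real n)))"
      using p0 \<delta> by (intro ennreal_plus[symmetric]) auto
    finally have "1 \<le> p (s j) j + (\<delta> + 8 / (\<epsilon>\<^sup>2 * real n))"
      using p0 \<delta> by (subst (asm) ennreal_le_iff) auto
    then show ?thesis using \<eta>(1) by simp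
  qed
  have "(\<Sum>j\<in>{0..M}. ennreal (p 1 j)) \<le> 1"
    using sum_iid_normal_hit_prob_le_1[OF te mS _ dS, of 1] by (simp add: p)
  then have "(\<Sum>j\<in>{0..M}. p 1 j) \<le> 1"
    using p0 by (simp add: sum_nonneg)
  moreover have "(\<Sum>j\<in>{0..M}. p 1 j) = p 1 0 + (\<Sum>j\<in>{1..M}. p 1 j)"
    by (simp add: sum.atLeast_Suc_atMost)
  \<comment> \<open>As \<open>s 0 = 1\<close>, scale 1 is itself one of the instances, so
    \<open>S 0\<close> takes its share there and the other \<open>M\<close> intervals together get
    at most \<open>\<delta> + \<eta>\<close>.\<close>
  moreover have "1 - \<delta> - \<eta> \<le> p 1 0" using ge[of 0] by (simp add: s_def)
  ultimately have sum: "(\<Sum>j\<in>{1..M}. p 1 j) \<le> \<delta> + \<eta>" by simp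
  obtain j where j: "j \<in> {1..M}" "p 1 j \<le> (\<delta> + \<eta>) / real M"
  proof (rule ccontr)
    assume "\<not> thesis"
    then have "\<And>j. j \<in> {1..M} \<Longrightarrow> (\<delta> + \<eta>) / real M < p 1 j" using that by force
    then have "(\<Sum>j\<in>{1..M}. (\<delta> + \<eta>) / real M) < (\<Sum>j\<in>{1..M}. p 1 j)"
      using M by (intro sum_strict_mono) auto
    then show False using sum M by simp
  qed
  let ?D = "1 / sqrt ((s j)\<^sup>2 * (2 - (s j)\<^sup>2))"
  have D0: "0 \<le> ?D" using s_lt[of j] by simp
  have D1: "?D \<le> D" using D[OF j(1)] by (simp add: s2 r_def)
  \<comment> \<open>The chosen interval is rare at scale 1 but likely at scale \<open>s j\<close>;
    the change of scale can bridge this gap only if \<open>k\<close> is large.\<close>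
  have "ennreal ((p (s j) j)\<^sup>2) \<le> ennreal (?D ^ k * p 1 j)"
    using iid_normal_hit_prob_le[OF te mS[of j] s(1)[of j] s_lt[of j]] D0 p0
    by (simp add: p[OF s(1)] p ennreal_power ennreal_mult)
  then have "(p (s j) j)\<^sup>2 \<le> ?D ^ k * p 1 j"
    using D0 p0 by (subst (asm) ennreal_le_iff) (auto intro!: mult_nonneg_nonneg zero_le_power)
  also have "\<dots> \<le> D ^ k * ((\<delta> + \<eta>) / real M)"
    using D0 D1 j(2) p0 order_trans[OF D0 D1] by (intro mult_mono power_mono zero_le_power) auto
  finally have "(p (s j) j)\<^sup>2 \<le> D ^ k * ((\<delta> + \<eta>) / real M)" .
  moreover have "(1 - \<delta> - \<eta>)\<^sup>2 \<le> (p (s j) j)\<^sup>2"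
    using ge[of j] \<eta>(2) by (intro power_mono) auto
  ultimately show ?thesis by linarith
qed

text \<open>The number y = u (2 - u) = 1 - (1 - u)^2 lies between a and 1, so 1 / sqrt y \<le> 1 / y
  = 1 + (1 - u)^2 / y, and 1 + t \<le> exp t finishes.\<close>

lemma inverse_sqrt_le_exp:
  fixes u :: real
  assumes "0 < a" "a \<le> u" "u \<le> 1" "1 - u \<le> x"
  shows "1 / sqrt (u * (2 - u)) \<le> exp (x\<^sup>2 / a)"
proof -
  define y where "y = u * (2 - u)"
  have y1: "y = 1 - (1 - u)\<^sup>2" by (simp add: y_def power2_eq_square algebra_simps)
  have "u * 1 \<le> y" unfolding y_def using assms by (intro mult_left_mono) auto
  then have ya: "a \<le> y" and y: "0 < y" using assms by auto
  have "y \<le> 1" by (simp add: y1)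
  then have "y \<le> sqrt y" using y by (intro real_le_rsqrt) (simp add: power2_eq_square mult_le_cancel_left1)
  then have "1 / sqrt y \<le> 1 / y" using y by (intro divide_left_mono) auto
  also have "1 / y = 1 + (1 - u)\<^sup>2 / y" using y by (simp add: y1 field_simps)
  also have "\<dots> \<le> exp ((1 - u)\<^sup>2 / y)" by (rule exp_ge_add_one_self)
  also have "\<dots> \<le> exp (x\<^sup>2 / a)"
    using assms ya by (simp, intro frac_le power_mono) auto
  finally show ?thesis by (simp add: y_def)
qed

text \<open>The constant is the \<open>1 / K\<close> of the proof, which depends only on
  \<open>\<epsilon>\<^sub>0\<close> and \<open>\<delta>\<^sub>0\<close>. It degenerates as either
  tends to 1: \<open>M\<close> grows without bound as \<open>\<delta>\<^sub>0\<close> does, and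
  \<open>a\<close> vanishes as \<open>\<epsilon>\<^sub>0\<close> does.\<close>

theorem theorem3:
  fixes \<epsilon>\<^sub>0 \<delta>\<^sub>0 :: real
  assumes "0 < \<epsilon>\<^sub>0" "\<epsilon>\<^sub>0 < 1" "0 < \<delta>\<^sub>0" "\<delta>\<^sub>0 < 1"
  shows "\<exists>c>0. \<forall>\<epsilon> \<delta>. 0 < \<epsilon> \<and> \<epsilon> \<le> \<epsilon>\<^sub>0 \<and> 0 < \<delta> \<and> \<delta> \<le> \<delta>\<^sub>0 \<longrightarrow>
    (\<exists>N. \<forall>n\<ge>N. \<forall>k Q H. eps_delta_estimator \<epsilon> \<delta> (psd_matrices n) n k Q H \<longrightarrow>
       real k \<ge> c * (1 / \<epsilon>\<^sup>2) * ln (1 / \<delta>))"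
proof -
  \<comment> \<open>Enough intervals that the numerical constants cancel at the end, leaving exactly
    \<open>1 / \<delta> \<le> D ^ k\<close>.\<close>
  define M where "M = nat \<lceil>8 / (1 - \<delta>\<^sub>0)\<^sup>2\<rceil>"
  have M8: "8 / (1 - \<delta>\<^sub>0)\<^sup>2 \<le> real M" unfolding M_def by linarith
  moreover have "0 < 8 / (1 - \<delta>\<^sub>0)\<^sup>2" using assms by simp
  ultimately have M: "0 < M" by linarith
  \<comment> \<open>A lower bound for all squared scales that occur, since r decreases in
    \<epsilon>.\<close>
  define a where "a = ((1 - \<epsilon>\<^sub>0) / (1 + \<epsilon>\<^sub>0)) ^ (2 * M)"
  have a: "0 < a" using assms by (simp add: a_def)
  define K where "K = 16 * (real M)\<^sup>2 / a"
  have K: "0 < K" using M a by (simp add: K_def)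
  show ?thesis
  proof (intro exI[of _ "1 / K"] conjI allI impI)
    show "0 < 1 / K" using K by simp
    fix \<epsilon> \<delta> :: real
    assume "0 < \<epsilon> \<and> \<epsilon> \<le> \<epsilon>\<^sub>0 \<and> 0 < \<delta> \<and> \<delta> \<le> \<delta>\<^sub>0"
    then have \<epsilon>: "0 < \<epsilon>" "\<epsilon> \<le> \<epsilon>\<^sub>0" "\<epsilon> < 1" and \<delta>: "0 < \<delta>" "\<delta> \<le> \<delta>\<^sub>0" using assms by auto
    \<comment> \<open>The first bound turns \<open>\<delta> + \<eta>\<close> into at most
      \<open>2 * \<delta>\<close>; the second keeps \<open>1 - \<delta> - \<eta>\<close> at least
      \<open>(1 - \<delta>\<^sub>0) / 2\<close>.\<close>
    define \<eta> where "\<eta> = min \<delta> ((1 - \<delta>\<^sub>0) / 2)"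
    have \<eta>: "0 < \<eta>" "\<eta> \<le> \<delta>" "\<delta> + \<eta> \<le> 1" "(1 - \<delta>\<^sub>0) / 2 \<le> 1 - \<delta> - \<eta>"
      using \<delta> assms by (auto simp: \<eta>_def min_def field_simps)
    define r where "r = (1 - \<epsilon>) / (1 + \<epsilon>)"
    have r: "0 < r" "r \<le> 1" "1 - r \<le> 2 * \<epsilon>" "(1 - \<epsilon>\<^sub>0) / (1 + \<epsilon>\<^sub>0) \<le> r"
    proof -
      show "(1 - \<epsilon>\<^sub>0) / (1 + \<epsilon>\<^sub>0) \<le> r"
        unfolding r_def using \<epsilon> assms by (intro frac_le) auto
      have "1 - r = 2 * \<epsilon> / (1 + \<epsilon>)" using \<epsilon> by (simp add: r_def field_simps)
      also have "\<dots> \<le> 2 * \<epsilon> / 1" using \<epsilon> by (intro divide_left_mono) auto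
      finally show "1 - r \<le> 2 * \<epsilon>" by simp
    qed (use \<epsilon> in \<open>simp_all add: r_def\<close>)
    define D where "D = exp (K * \<epsilon>\<^sup>2)"
    have D: "1 / sqrt (r ^ (2 * j) * (2 - r ^ (2 * j))) \<le> D" if "j \<in> {1..M}" for j
    proof -
      have "a \<le> r ^ (2 * M)"
        unfolding a_def using r(4) assms by (intro power_mono) auto
      also have "\<dots> \<le> r ^ (2 * j)"
        using that r by (intro power_decreasing) auto
      finally have "a \<le> r ^ (2 * j)" .
      moreover have "r ^ (2 * j) \<le> 1" using r by (intro power_le_one) auto
      moreover have "1 - r ^ (2 * j) \<le> 4 * real M * \<epsilon>"
      proof -
        \<comment> \<open>Bernoulli makes the change of variance linear in \<epsilon>; its square in
          the exponent gives the rate \<epsilon>^2 per query.\<close>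
        have "1 - r ^ (2 * j) \<le> real (2 * j) * (1 - r)"
          using Bernoulli_inequality[of "r - 1" "2 * j"] r by (simp add: algebra_simps)
        also have "\<dots> \<le> real (2 * M) * (2 * \<epsilon>)"
          using that r by (intro mult_mono) auto
        finally show ?thesis by simp
      qed
      ultimately have "1 / sqrt (r ^ (2 * j) * (2 - r ^ (2 * j))) \<le> exp ((4 * real M * \<epsilon>)\<^sup>2 / a)"
        by (rule inverse_sqrt_le_exp[OF a])
      then show ?thesis by (simp add: D_def K_def power_mult_distrib)
    qed
    show "\<exists>N. \<forall>n\<ge>N. \<forall>k Q H. eps_delta_estimator \<epsilon> \<delta> (psd_matrices n) n k Q H \<longrightarrow>
       real k \<ge> 1 / K * (1 / \<epsilon>\<^sup>2) * ln (1 / \<delta>)"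
    \<comment> \<open>This dimension brings the Chebyshev error
      \<open>8 / (\<epsilon>\<^sup>2 * real n)\<close> below \<eta>.\<close>
    proof (intro exI[of _ "nat \<lceil>8 / (\<epsilon>\<^sup>2 * \<eta>)\<rceil>"] allI impI)
      fix n k :: nat and Q H
      assume "nat \<lceil>8 / (\<epsilon>\<^sup>2 * \<eta>)\<rceil> \<le> n" and E: "eps_delta_estimator \<epsilon> \<delta> (psd_matrices n) n k Q H"
      then have nN: "8 / (\<epsilon>\<^sup>2 * \<eta>) \<le> real n" by linarith
      moreover have "0 < 8 / (\<epsilon>\<^sup>2 * \<eta>)" using \<epsilon> \<eta> by simp
      ultimately have n: "0 < n" by linarith
      have \<eta>n: "8 / (\<epsilon>\<^sup>2 * real n) \<le> \<eta>"
        using nN n \<epsilon> \<eta>(1) by (simp add: field_simps)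
      have "((1 - \<delta>\<^sub>0) / 2)\<^sup>2 \<le> (1 - \<delta> - \<eta>)\<^sup>2"
        using \<eta>(4) assms by (intro power_mono) auto
      also have "\<dots> \<le> D ^ k * ((\<delta> + \<eta>) / real M)"
        using E \<epsilon>(1,3) _ n \<eta>n \<eta>(3) M
        by (rule estimator_query_inequality) (use \<delta> D in \<open>auto simp: r_def\<close>)
      also have "\<dots> \<le> D ^ k * (2 * \<delta> / real M)"
        using \<eta>(2) by (intro mult_left_mono divide_right_mono) (auto simp: D_def)
      finally have "real M * (1 - \<delta>\<^sub>0)\<^sup>2 \<le> 8 * (D ^ k * \<delta>)"
        using M by (simp add: power_divide field_simps)
      moreover have "8 \<le> real M * (1 - \<delta>\<^sub>0)\<^sup>2"
        using M8 assms by (simp add: divide_le_eq)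
      ultimately have "1 / \<delta> \<le> D ^ k" using \<delta> by (simp add: divide_le_eq)
      then have "ln (1 / \<delta>) \<le> ln (D ^ k)" using \<delta> by (intro ln_mono) auto
      also have "\<dots> = real k * (K * \<epsilon>\<^sup>2)" by (simp add: D_def ln_realpow)
      finally show "real k \<ge> 1 / K * (1 / \<epsilon>\<^sup>2) * ln (1 / \<delta>)"
        using K \<epsilon>(1) by (simp add: field_simps)
    qed
  qed
qed

end
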